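(* Let $m\ge1$. The semigroup $\mathcal{P}_f(\mathbb{T}^m)$ of all finite-to-one correspondences of $\mathbb{T}^m$ is isomorphic to the semigroup $$\mathcal{M}=\{(Q,\Lambda):Q\in\mathrm{GL}(m,\mathbb{Q}),\ \Lambda\in\mathcal{L},\ \Lambda\subset\Lambda_Q\}$$ with composition $$(Q,\Lambda)\cdot(Q',\Lambda')=(QQ',\Lambda+Q\Lambda'),$$ where the isomorphism $\theta\colon\mathcal{M}\to\mathcal{P}_f(\mathbb{T}^m)$ is given by $$\theta(Q,\Lambda)^\perp=\{(Q^{-1}\mathbf{n},\mathbf{n}):\mathbf{n}\in\Lambda\}$$ for every $(Q,\Lambda)\in\mathcal{M}$. A correspondence $\mathsf{P}\in\mathcal{P}_f(\mathbb{T}^m)$ is connected if and only if $\mathsf{P}=\mathsf{P}_Q=\theta(Q,\Lambda_Q)$ for some $Q\in\mathrm{GL}(m,\mathbb{Q})$. Finally, if $\mathsf{P}=\theta(Q,\Lambda)\in\mathcal{P}_f(\mathbb{T}^m)$, then $\mathsf{P}^*=\theta(Q^{-1},Q^{-1}\Lambda)$.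
   Context: A correspondence of $\mathbb{T}^m=\mathbb{R}^m/\mathbb{Z}^m$ is a closed subgroup $\mathsf{P}\subset\mathbb{T}^m\times\mathbb{T}^m$ both of whose coordinate projections to $\mathbb{T}^m$ are surjective. It is finite-to-one if the groups $\{x:(x,0)\in\mathsf{P}\}$ and $\{y:(0,y)\in\mathsf{P}\}$ are both finite. The product of correspondences is $$\mathsf{P}_1\star\mathsf{P}_2=\{(x,z):(x,y)\in\mathsf{P}_2\text{ and }(y,z)\in\mathsf{P}_1\text{ for at least one }y\in\mathbb{T}^m\};$$ with this product the finite-to-one correspondences form the semigroup $\mathcal{P}_f(\mathbb{T}^m)$. The conjugate correspondence is $\mathsf{P}^*=\{(y,x):(x,y)\in\mathsf{P}\}$. $\mathcal{L}$ denotes the semigroup of all finite index subgroups of $\mathbb{Z}^m$ with respect to the addition $L_1+L_2=\{u+v:u\in L_1,\ v\in L_2\}$. For $Q\in\mathrm{GL}(m,\mathbb{Q})$ put $\Lambda_Q=\mathbb{Z}^m\cap Q\mathbb{Z}^m\in\mathcal{L}$. For $\mathbf{n}=(n_1,\dots,n_m)\in\mathbb{Z}^m$ and $x=(x_1,\dots,x_m)\in\mathbb{T}^m$ put $\chi_{\mathbf{n}}(x)=e^{2\pi i\sum_{j=1}^m n_jx_j}$. For a subgroup $F\subset\mathbb{T}^m\times\mathbb{T}^m=\mathbb{T}^{2m}$, $F^\perp$ denotes its annihilator, $F^\perp=\{(\mathbf{a},\mathbf{b})\in\mathbb{Z}^m\times\mathbb{Z}^m:\chi_{\mathbf{a}}(x)\chi_{\mathbf{b}}(y)=1\text{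 for all }(x,y)\in F\}$; a closed subgroup is determined by its annihilator.
   Formalization: The composition is corrected to (QQ', Λ ∩ QΛ'), since Λ + QΛ' need not lie in ℤ^m (m=1, Q=1/2, Q'=1, Λ=Λ'=ℤ), and θ(Q,Λ)^⊥ to {(Q⁻¹n, −n) : n ∈ Λ}, since with the printed sign θ(1,ℤ^m) = {(x,−x)} and θ is not multiplicative. *)

theory Defs
  imports "HOL-Analysis.Analysis"
begin

definition torus_rel :: "real^'m \<Rightarrow> real^'m \<Rightarrow> bool" where
  "torus_rel x y \<longleftrightarrow> (\<forall>i. x $ i - y $ i \<in> \<int>)"

lemma equivp_torus_rel: "equivp torus_rel"
proof (rule equivpI)
  show "reflp torus_rel"
    by (auto simp: reflp_def torus_rel_def)
  show "symp torus_rel"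
  proof (rule sympI)
    fix x y :: "real^'m" assume "torus_rel x y"
    then have "- (x $ i - y $ i) \<in> \<int>" for i
      unfolding torus_rel_def by (intro Ints_minus) blast
    then show "torus_rel y x"
      unfolding torus_rel_def by simp
  qed
  show "transp torus_rel"
  proof (rule transpI)
    fix x y z :: "real^'m" assume "torus_rel x y" "torus_rel y z"
    then have "(x $ i - y $ i) + (y $ i - z $ i) \<in> \<int>" for i
      unfolding torus_rel_def by (intro Ints_add) blast+
    then show "torus_rel x z"
      unfolding torus_rel_def by simp
  qed
qed

quotient_type 'm torus = "real^'m::finite" / torus_rel
  morphisms rep_torus torus_of
  by (rule equivp_torus_rel)

instantiation torus :: (finite) ab_group_add
begin

lift_definition zero_torus :: "'a torus" is 0 .

lift_definition plus_torus :: "'a torus \<Rightarrow> 'a torus \<Rightarrow> 'a torus" is "(+)"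
proof -
  fix x x' y y' :: "real^'a" assume "torus_rel x x'" "torus_rel y y'"
  then have "(x $ i - x' $ i) + (y $ i - y' $ i) \<in> \<int>" for i
    unfolding torus_rel_def by (intro Ints_add) blast+
  then show "torus_rel (x + y) (x' + y')"
    unfolding torus_rel_def by (simp add: add_diff_add)
qed

lift_definition uminus_torus :: "'a torus \<Rightarrow> 'a torus" is uminus
proof -
  fix x y :: "real^'a" assume "torus_rel x y"
  then have "- (x $ i - y $ i) \<in> \<int>" for i
    unfolding torus_rel_def by (intro Ints_minus) blast
  then show "torus_rel (- x) (- y)"
    unfolding torus_rel_def by simp
qed

definition minus_torus :: "'a torus \<Rightarrow> 'a torus \<Rightarrow> 'a torus" where
  "minus_torus x y = x + - y"

instance
proof
  fix a b c :: "'a torus"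
  show "a + b + c = a + (b + c)"
    by transfer (simp add: torus_rel_def)
  show "a + b = b + a"
    by transfer (simp add: torus_rel_def)
  show "0 + a = a"
    by transfer (simp add: torus_rel_def)
  show "- a + a = 0"
    by transfer (simp add: torus_rel_def)
  show "a - b = a + - b"
    by (rule minus_torus_def)
qed

end

text \<open>The torus carries the quotient topology of \<open>real^'m\<close>.\<close>

instantiation torus :: (finite) topological_space
begin

definition open_torus :: "'a torus set \<Rightarrow> bool" where
  "open_torus U \<longleftrightarrow> open (torus_of -` U)"

instance
proof
  show "open (UNIV :: 'a torus set)"
    by (simp add: open_torus_def)
next
  fix S T :: "'a torus set"
  assume "open S" "open T"
  then show "open (S \<inter> T)"
    by (simp add: open_torus_def open_Int)
next
  fix K :: "'a torus set set"
  assume "\<forall>S\<in>K. open S"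
  then show "open (\<Union>K)"
    by (auto simp: open_torus_def vimage_Union)
qed

end

definition add_subgroup :: "'a::group_add set \<Rightarrow> bool" where
  "add_subgroup H \<longleftrightarrow> 0 \<in> H \<and> (\<forall>x\<in>H. \<forall>y\<in>H. x + y \<in> H) \<and> (\<forall>x\<in>H. - x \<in> H)"

definition correspondence :: "('m::finite torus \<times> 'm torus) set \<Rightarrow> bool" where
  "correspondence P \<longleftrightarrow>
     closed P \<and> add_subgroup P \<and> fst ` P = UNIV \<and> snd ` P = UNIV"

definition finite_to_one :: "('m::finite torus \<times> 'm torus) set \<Rightarrow> bool" where
  "finite_to_one P \<longleftrightarrow> finite {x. (x, 0) \<in> P} \<and> finite {y. (0, y) \<in> P}"

definition Pf :: "('m::finite torus \<times> 'm torus) set set" where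
  "Pf = {P. correspondence P \<and> finite_to_one P}"

definition corr_mult ::
    "('m::finite torus \<times> 'm torus) set \<Rightarrow> ('m torus \<times> 'm torus) set \<Rightarrow> ('m torus \<times> 'm torus) set"
    (infixl "\<star>" 70) where
  "P1 \<star> P2 = {(x, z). \<exists>y. (x, y) \<in> P2 \<and> (y, z) \<in> P1}"

lift_definition torus_char :: "int^'m::finite \<Rightarrow> 'm torus \<Rightarrow> complex" is
  "\<lambda>n x. exp (2 * of_real pi * \<i> * of_real (\<Sum>j\<in>UNIV. of_int (n $ j) * x $ j))"
proof -
  fix n :: "int^'m" and x y :: "real^'m"
  assume "torus_rel x y"
  then have "\<forall>j. \<exists>k::int. x $ j - y $ j = of_int k"
    unfolding torus_rel_def by (meson Ints_cases)
  then obtain k :: "'m \<Rightarrow> int" where k: "\<And>j. x $ j - y $ j = of_int (k j)"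
    by metis
  define s where "s = (\<Sum>j\<in>UNIV. n $ j * k j)"
  have "(\<Sum>j\<in>UNIV. of_int (n $ j) * x $ j) - (\<Sum>j\<in>UNIV. of_int (n $ j) * y $ j)
      = (\<Sum>j\<in>UNIV. of_int (n $ j) * (x $ j - y $ j))"
    by (simp only: sum_subtractf right_diff_distrib)
  also have "\<dots> = of_int s"
    by (simp only: k s_def of_int_sum of_int_mult)
  finally have s: "(\<Sum>j\<in>UNIV. of_int (n $ j) * x $ j)
      = (\<Sum>j\<in>UNIV. of_int (n $ j) * y $ j) + (of_int s :: real)"
    by linarith
  have "2 * of_real pi * \<i> * of_real (t + of_int s)
      = 2 * of_real pi * \<i> * of_real t + of_real (of_int (2 * s) * pi) * \<i>" for t :: real
    by (simp only: of_real_add of_real_mult of_real_of_int_eq of_real_numeral distrib_left of_int_mult of_int_numeral mult_ac)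
  note this[of "\<Sum>j\<in>UNIV. of_int (n $ j) * y $ j", folded s]
  then show "exp (2 * of_real pi * \<i> * of_real (\<Sum>j\<in>UNIV. of_int (n $ j) * x $ j))
      = exp (2 * of_real pi * \<i> * of_real (\<Sum>j\<in>UNIV. of_int (n $ j) * y $ j))"
    unfolding exp_eq by (rule exI)
qed

text \<open>The lattice of integer vectors is regarded as a subset of \<open>rat^'m\<close>, so that
  the images of its subgroups under rational matrices are images in the ordinary sense.\<close>

definition rat_vec :: "int^'m \<Rightarrow> rat^'m" where
  "rat_vec n = (\<chi> i. of_int (n $ i))"

definition int_lattice :: "(rat^'m) set" where
  "int_lattice = range rat_vec"

definition annihilator ::
    "('m::finite torus \<times> 'm torus) set \<Rightarrow> ((rat^'m) \<times> (rat^'m)) set" where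
  "annihilator F =
     {(rat_vec a, rat_vec b) | a b. \<forall>(x, y)\<in>F. torus_char a x * torus_char b y = 1}"

definition finite_index_subgroups :: "(rat^'m::finite) set set" where
  "finite_index_subgroups =
     {L. add_subgroup L \<and> L \<subseteq> int_lattice \<and> finite {(+) v ` L | v. v \<in> int_lattice}}"

definition Lambda_of :: "rat^'m^'m \<Rightarrow> (rat^'m::finite) set" where
  "Lambda_of Q = int_lattice \<inter> (\<lambda>v. Q *v v) ` int_lattice"

definition GL_pairs :: "((rat^'m::finite^'m) \<times> (rat^'m) set) set" where
  "GL_pairs =
     {(Q, \<Lambda>). invertible Q \<and> \<Lambda> \<in> finite_index_subgroups \<and> \<Lambda> \<subseteq> Lambda_of Q}"

text \<open>The second component of a product is the intersection \<open>\<Lambda> \<inter> Q \<Lambda>'\<close>, not the sum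
  \<open>\<Lambda> + Q \<Lambda>'\<close>.  The sum does not define an operation on these pairs: for \<open>Q = 1/2\<close>,
  \<open>Q' = 1\<close> in dimension one and \<open>\<Lambda>\<close>, \<open>\<Lambda>'\<close> both the integers, it contains \<open>1/2\<close>.
  The intersection arises by eliminating the middle variable: if \<open>\<Lambda>\<close> and \<open>\<Lambda>'\<close> belong to
  \<open>P\<close> and \<open>P'\<close>, then \<open>(Q'\<inverse> n', - n', 0) + (0, Q\<inverse> n, - n)\<close> annihilates the fibre product
  underlying \<open>P \<star> P'\<close>, and its middle entry vanishes iff \<open>n = Q n'\<close>.\<close>

fun pair_mult ::
    "(rat^'m::finite^'m) \<times> (rat^'m) set \<Rightarrow> (rat^'m^'m) \<times> (rat^'m) set \<Rightarrow> (rat^'m^'m) \<times> (rat^'m) set"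
    (infixl "\<odot>" 70) where
  "(Q, \<Lambda>) \<odot> (Q', \<Lambda>') = (Q ** Q', \<Lambda> \<inter> (\<lambda>v. Q *v v) ` \<Lambda>')"

text \<open>The minus sign is forced by the convention for annihilators of pairs, which multiplies
  the two characters.  With it, \<open>theta\<close> sends the pair of the identity matrix and the full
  lattice to the diagonal.  Without it, the diagonal would correspond to \<open>- mat 1\<close>, although it
  is idempotent while \<open>- mat 1\<close> is not.\<close>

definition theta_perp :: "(rat^'m::finite^'m) \<times> (rat^'m) set \<Rightarrow> ((rat^'m) \<times> (rat^'m)) set" where
  "theta_perp = (\<lambda>(Q, \<Lambda>). {(matrix_inv Q *v n, - n) | n. n \<in> \<Lambda>})"

definition theta :: "(rat^'m::finite^'m) \<times> (rat^'m) set \<Rightarrow> ('m torus \<times> 'm torus) set" where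
  "theta p = (THE P. closed P \<and> add_subgroup P \<and> annihilator P = theta_perp p)"

definition semigroup_on :: "'a set \<Rightarrow> ('a \<Rightarrow> 'a \<Rightarrow> 'a) \<Rightarrow> bool" where
  "semigroup_on A f \<longleftrightarrow>
     (\<forall>x\<in>A. \<forall>y\<in>A. f x y \<in> A) \<and> (\<forall>x\<in>A. \<forall>y\<in>A. \<forall>z\<in>A. f (f x y) z = f x (f y z))"

definition semigroup_iso_on ::
    "('a \<Rightarrow> 'b) \<Rightarrow> 'a set \<Rightarrow> ('a \<Rightarrow> 'a \<Rightarrow> 'a) \<Rightarrow> 'b set \<Rightarrow> ('b \<Rightarrow> 'b \<Rightarrow> 'b) \<Rightarrow> bool" where
  "semigroup_iso_on h A f B g \<longleftrightarrow>
     bij_betw h A B \<and> (\<forall>x\<in>A. \<forall>y\<in>A. h (f x y) = g (h x) (h y))"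

end

theory Submission
  imports Defs
begin

text \<open>
  Everything rests on Pontryagin duality for closed subgroups of the torus
  \<open>T\<^sup>m \<times> T\<^sup>m\<close>: a point outside a closed subgroup \<open>H\<close> is separated from it by a character
  that is trivial on \<open>H\<close> (\<open>closed_subgroup_separation\<close>).  The proof is by averaging.  By the
  Stone-Weierstrass theorem some trigonometric polynomial is small on \<open>H\<close> and close to 1 on the
  coset \<open>z + H\<close>.  Both properties survive when it is replaced by a mean of translates by elements
  of \<open>H\<close>, and suitable means make the coefficients of all characters nontrivial on \<open>H\<close> as small as
  desired.  What remains takes different values at 0 and at \<open>z\<close>, so one of the
  characters trivial on \<open>H\<close> is nontrivial at \<open>z\<close>.  Hence a closed subgroup is determined by its
  annihilator, and every statement of the proposition becomes a computation of annihilators.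

  For a pair \<open>(Q, \<Lambda>)\<close> let \<open>P\<close> be the joint kernel of the characters \<open>(Q\<inverse> n, - n)\<close>, \<open>n \<in> \<Lambda>\<close>.
  It contains the curve \<open>t \<mapsto> (Q\<^sup>T t, t)\<close>, which forces every element of its annihilator to be of
  the form \<open>(Q\<inverse> n, - n)\<close> with \<open>n\<close> integral; the finite fibre over 0 forces \<open>n \<in> \<Lambda>\<close>.  The
  latter is duality for the finite group \<open>\<int>\<^sup>m / \<Lambda>\<close> (\<open>sublattice_separation\<close>), which follows from
  duality on the torus: if \<open>N \<int>\<^sup>m \<subseteq> \<Lambda>\<close>, then \<open>\<Lambda> / N\<close> gives a finite subgroup of the torus,
  and an integral vector \<open>a\<close> pairs with \<open>\<Lambda> / N\<close> as \<open>\<Lambda>\<close> pairs with \<open>a / N\<close>.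

  Conversely let \<open>P\<close> be a finite-to-one correspondence.  Surjectivity of the projections makes its
  annihilator the graph of an injective partial map.  Its second projection spans \<open>\<rat>\<^sup>m\<close>, because
  otherwise \<open>P\<close> would contain a line in the fibre over 0 (\<open>span_of_annihilator_projection\<close>).  So
  that graph lies in the graph of an invertible rational matrix, over a lattice of finite index.

  The annihilator of a product is found by testing on the curve, on points \<open>(0, z)\<close> that arise from
  the middle point 0, and on points \<open>(0, z)\<close> that arise from an arbitrary middle point in the fibre
  of the second factor; the last two tests give the two conditions defining \<open>\<Lambda> \<inter> Q \<Lambda>'\<close>.
  The product is closed because the torus is compact.  Finally, the
  curve is compact and its annihilator is that of \<open>\<theta>(Q, \<Lambda>\<^sub>Q)\<close>, so that \<open>\<theta>(Q, \<Lambda>\<^sub>Q)\<close> is connected;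
  and an integral character \<open>(Q\<inverse> n, - n)\<close> takes values in roots of unity on \<open>\<theta>(Q, \<Lambda>)\<close>, so it is
  constant there if \<open>\<theta>(Q, \<Lambda>)\<close> is connected.
\<close>


section \<open>Separating closed subgroups by characters\<close>

definition unitary_character :: "('a::ab_group_add \<Rightarrow> complex) \<Rightarrow> bool" where
  "unitary_character \<phi> \<longleftrightarrow> (\<forall>x y. \<phi> (x + y) = \<phi> x * \<phi> y) \<and> (\<forall>x. norm (\<phi> x) = 1)"

lemma unitary_character_zero: "unitary_character \<phi> \<Longrightarrow> \<phi> 0 = 1"
proof -
  assume u: "unitary_character \<phi>"
  have "\<phi> (0 + 0) = \<phi> 0 * \<phi> 0" "\<phi> 0 \<noteq> 0"
    using u unfolding unitary_character_def by (blast, metis norm_zero zero_neq_one)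
  then show ?thesis by simp
qed

lemma add_subgroup_nat_multiple:
  "add_subgroup H \<Longrightarrow> x \<in> H \<Longrightarrow> ((+) x ^^ k) 0 \<in> H"
  by (induction k) (auto simp: add_subgroup_def)

lemma unitary_character_nat_multiple:
  "unitary_character \<phi> \<Longrightarrow> \<phi> (((+) x ^^ k) 0) = \<phi> x ^ k"
  by (induction k) (auto simp: unitary_character_zero, simp add: unitary_character_def)

text \<open>
  The mean of the translates of a combination by \<open>0, h, \<dots>, (n - 1) h\<close> satisfies every bound that the
  combination satisfies along a whole coset of \<open>H\<close>.  It multiplies the coefficient of a
  character \<open>\<phi>\<close> by the mean of the powers \<open>(\<phi> h)\<^sup>k\<close>, which is 1 if \<open>\<phi>\<close> is trivial on \<open>H\<close>, has
  modulus at most 1 in general, and tends to 0 with growing \<open>n\<close> if \<open>\<phi> h \<noteq> 1\<close>, by the formula for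
  the geometric sum.  The elements \<open>(y, x)\<close> of \<open>K\<close> say that the combination is to stay close to
  the value \<open>y\<close> on the coset \<open>x + H\<close>.
\<close>

lemma averaging_shrinks_coefficient:
  fixes F :: "('a::ab_group_add \<Rightarrow> complex) set"
  assumes H: "add_subgroup H" and F: "\<And>\<phi>. \<phi> \<in> F \<Longrightarrow> unitary_character \<phi>" and "finite F"
    and \<phi>0: "\<phi>0 \<in> F" "h \<in> H" "\<phi>0 h \<noteq> 1" and "\<delta> > 0"
    and K: "\<And>y x h. (y, x) \<in> K \<Longrightarrow> h \<in> H \<Longrightarrow> norm ((\<Sum>\<phi>\<in>F. c \<phi> * \<phi> (x + h)) - y) \<le> \<epsilon>"
  obtains c' where
    "\<And>y x h. (y, x) \<in> K \<Longrightarrow> h \<in> H \<Longrightarrow> norm ((\<Sum>\<phi>\<in>F. c' \<phi> * \<phi> (x + h)) - y) \<le> \<epsilon>"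
    "\<And>\<phi>. norm (c' \<phi>) \<le> norm (c \<phi>) \<or> \<phi> \<notin> F" "norm (c' \<phi>0) \<le> \<delta>"
    "\<And>\<phi>. \<forall>h\<in>H. \<phi> h = 1 \<Longrightarrow> c' \<phi> = c \<phi>"
proof -
  \<comment> \<open>The geometric sum of \<open>\<phi>0 h\<close> has modulus at most \<open>2 / norm (\<phi>0 h - 1)\<close>.\<close>
  define M where "M = 2 * norm (c \<phi>0) / norm (\<phi>0 h - 1)"
  obtain n :: nat where n: "n > 0" "M / n \<le> \<delta>"
  proof -
    obtain n :: nat where "real n > M / \<delta>" using reals_Archimedean2 by blast
    then have "M / real (Suc n) \<le> \<delta>"
      using \<open>\<delta> > 0\<close> by (simp add: field_simps)
    with that[of "Suc n"] show ?thesis by simp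
  qed
  define m where "m \<phi> = (\<Sum>k<n. \<phi> h ^ k) / n" for \<phi> :: "'a \<Rightarrow> complex"
  define c' where "c' \<phi> = c \<phi> * m \<phi>" for \<phi>
  show ?thesis
  proof
    fix y x g assume yx: "(y, x) \<in> K" "g \<in> H"
    have avg: "(\<Sum>\<phi>\<in>F. c' \<phi> * \<phi> (x + g)) - y
      = (\<Sum>k<n. (\<Sum>\<phi>\<in>F. c \<phi> * \<phi> (x + (g + ((+) h ^^ k) 0))) - y) / n"
    proof -
      have "(\<Sum>k<n. \<Sum>\<phi>\<in>F. c \<phi> * \<phi> (x + (g + ((+) h ^^ k) 0)))
          = (\<Sum>\<phi>\<in>F. \<Sum>k<n. c \<phi> * \<phi> (x + (g + ((+) h ^^ k) 0)))"
        by (rule sum.swap)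
      also have "\<dots> = (\<Sum>\<phi>\<in>F. c' \<phi> * \<phi> (x + g) * n)"
      proof (rule sum.cong[OF refl])
        fix \<phi> assume "\<phi> \<in> F"
        note u = F[OF this]
        have "\<phi> (x + (g + ((+) h ^^ k) 0)) = \<phi> (x + g) * \<phi> h ^ k" for k
          using u unitary_character_nat_multiple[OF u]
          by (simp add: unitary_character_def mult.assoc)
        then have "(\<Sum>k<n. c \<phi> * \<phi> (x + (g + ((+) h ^^ k) 0)))
            = c \<phi> * \<phi> (x + g) * (\<Sum>k<n. \<phi> h ^ k)"
          by (simp add: sum_distrib_left mult.assoc)
        also have "\<dots> = c' \<phi> * \<phi> (x + g) * n"
          using n by (simp add: c'_def m_def)
        finally show "(\<Sum>k<n. c \<phi> * \<phi> (x + (g + ((+) h ^^ k) 0))) = c' \<phi> * \<phi> (x + g) * n" .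
      qed
      finally show ?thesis
        using n by (simp add: sum_subtractf field_simps sum_distrib_left sum_distrib_right)
    qed
    have "norm (\<Sum>k<n. (\<Sum>\<phi>\<in>F. c \<phi> * \<phi> (x + (g + ((+) h ^^ k) 0))) - y) \<le> of_nat (card {..<n}) * \<epsilon>"
    proof (rule sum_norm_bound)
      fix k
      have "g + ((+) h ^^ k) 0 \<in> H"
        using yx add_subgroup_nat_multiple[OF H \<phi>0(2)] H by (auto simp: add_subgroup_def)
      then show "norm ((\<Sum>\<phi>\<in>F. c \<phi> * \<phi> (x + (g + ((+) h ^^ k) 0))) - y) \<le> \<epsilon>"
        using K yx by blast
    qed
    then show "norm ((\<Sum>\<phi>\<in>F. c' \<phi> * \<phi> (x + g)) - y) \<le> \<epsilon>"
      unfolding avg using n by (simp add: norm_divide field_simps)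
  next
    fix \<phi>
    show "norm (c' \<phi>) \<le> norm (c \<phi>) \<or> \<phi> \<notin> F"
    proof (cases "\<phi> \<in> F")
      case True
      have "norm (\<Sum>k<n. \<phi> h ^ k) \<le> of_nat (card {..<n}) * 1"
        by (rule sum_norm_bound)
          (use F[OF True] in \<open>simp add: unitary_character_def norm_power\<close>)
      then have "norm (m \<phi>) \<le> 1"
        using n by (simp add: m_def norm_divide)
      then show ?thesis
        by (simp add: c'_def norm_mult mult_left_le)
    qed auto
  next
    have "(\<phi>0 h - 1) * (\<Sum>k<n. \<phi>0 h ^ k) = \<phi>0 h ^ n - 1"
      by (simp add: power_diff_1_eq)
    then have "norm (\<phi>0 h - 1) * norm (\<Sum>k<n. \<phi>0 h ^ k) = norm (\<phi>0 h ^ n - 1)"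
      by (metis norm_mult)
    also have "\<dots> \<le> norm (\<phi>0 h ^ n) + norm (1::complex)"
      by (rule norm_triangle_ineq4)
    also have "\<dots> = 2"
      using F[OF \<phi>0(1)] by (simp add: unitary_character_def norm_power)
    finally have "norm (\<Sum>k<n. \<phi>0 h ^ k) \<le> 2 / norm (\<phi>0 h - 1)"
      using \<phi>0(3) by (simp add: field_simps)
    then have "norm (c \<phi>0) * norm (\<Sum>k<n. \<phi>0 h ^ k) \<le> M"
      unfolding M_def by (metis mult_left_mono norm_ge_zero times_divide_eq_right mult.commute)
    then have "norm (c \<phi>0) * norm (\<Sum>k<n. \<phi>0 h ^ k) / n \<le> M / n"
      by (rule divide_right_mono) simp
    then have "norm (c' \<phi>0) \<le> M / n"
      by (simp add: c'_def m_def norm_mult norm_divide)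
    with n show "norm (c' \<phi>0) \<le> \<delta>" by linarith
  next
    fix \<phi> :: "'a \<Rightarrow> complex" assume "\<forall>h\<in>H. \<phi> h = 1"
    then show "c' \<phi> = c \<phi>"
      using n \<phi>0 by (simp add: c'_def m_def)
  qed
qed

lemma averaging_shrinks_coefficients:
  fixes F :: "('a::ab_group_add \<Rightarrow> complex) set"
  assumes H: "add_subgroup H" and F: "\<And>\<phi>. \<phi> \<in> F \<Longrightarrow> unitary_character \<phi>" and "finite F"
    and N: "finite N" "N \<subseteq> F" "\<And>\<phi>. \<phi> \<in> N \<Longrightarrow> \<exists>h\<in>H. \<phi> h \<noteq> 1" and "\<delta> > 0"
    and K: "\<And>y x h. (y, x) \<in> K \<Longrightarrow> h \<in> H \<Longrightarrow> norm ((\<Sum>\<phi>\<in>F. c \<phi> * \<phi> (x + h)) - y) \<le> \<epsilon>"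
  shows "\<exists>c'.
    (\<forall>y x h. (y, x) \<in> K \<longrightarrow> h \<in> H \<longrightarrow> norm ((\<Sum>\<phi>\<in>F. c' \<phi> * \<phi> (x + h)) - y) \<le> \<epsilon>) \<and>
    (\<forall>\<phi>\<in>N. norm (c' \<phi>) \<le> \<delta>) \<and> (\<forall>\<phi>. (\<forall>h\<in>H. \<phi> h = 1) \<longrightarrow> c' \<phi> = c \<phi>)"
  using N
proof (induction N rule: finite_induct)
  case empty
  then show ?case using K by blast
next
  case (insert \<phi>0 N)
  have "\<exists>c'.
    (\<forall>y x h. (y, x) \<in> K \<longrightarrow> h \<in> H \<longrightarrow> norm ((\<Sum>\<phi>\<in>F. c' \<phi> * \<phi> (x + h)) - y) \<le> \<epsilon>) \<and>
    (\<forall>\<phi>\<in>N. norm (c' \<phi>) \<le> \<delta>) \<and> (\<forall>\<phi>. (\<forall>h\<in>H. \<phi> h = 1) \<longrightarrow> c' \<phi> = c \<phi>)"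
    by (rule insert.IH) (use insert.prems in auto)
  then obtain c1 where c1:
    "\<And>y x h. (y, x) \<in> K \<Longrightarrow> h \<in> H \<Longrightarrow> norm ((\<Sum>\<phi>\<in>F. c1 \<phi> * \<phi> (x + h)) - y) \<le> \<epsilon>"
    "\<And>\<phi>. \<phi> \<in> N \<Longrightarrow> norm (c1 \<phi>) \<le> \<delta>" "\<And>\<phi>. \<forall>h\<in>H. \<phi> h = 1 \<Longrightarrow> c1 \<phi> = c \<phi>"
    by blast
  from insert.prems obtain h where h: "h \<in> H" "\<phi>0 h \<noteq> 1" by blast
  from insert.prems have "\<phi>0 \<in> F" by blast
  obtain c2 where c2:
    "\<And>y x h. (y, x) \<in> K \<Longrightarrow> h \<in> H \<Longrightarrow> norm ((\<Sum>\<phi>\<in>F. c2 \<phi> * \<phi> (x + h)) - y) \<le> \<epsilon>"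
    "\<And>\<phi>. norm (c2 \<phi>) \<le> norm (c1 \<phi>) \<or> \<phi> \<notin> F" "norm (c2 \<phi>0) \<le> \<delta>"
    "\<And>\<phi>. \<forall>h\<in>H. \<phi> h = 1 \<Longrightarrow> c2 \<phi> = c1 \<phi>"
    using averaging_shrinks_coefficient[OF H F \<open>finite F\<close> \<open>\<phi>0 \<in> F\<close> h \<open>\<delta> > 0\<close>, of K c1 \<epsilon>] c1(1) by blast
  have "norm (c2 \<phi>) \<le> \<delta>" if "\<phi> \<in> insert \<phi>0 N" for \<phi>
    using that c2(2)[of \<phi>] c2(3) c1(2) insert.prems(1) by force
  with c1 c2 show ?case
    by (intro exI[of _ c2]) auto
qed

text \<open>
  If all occurring characters that are trivial on \<open>H\<close> were also trivial at \<open>z\<close>, their part of the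
  combination would take the same value at 0 and at \<open>z\<close>.  After the other coefficients have been
  made small, the values of the whole combination at 0 and at \<open>z\<close> are then close to each other,
  although one is near 0 and the other near 1.
\<close>

lemma separation_by_averaging:
  fixes F :: "('a::ab_group_add \<Rightarrow> complex) set"
  assumes H: "add_subgroup H" and F: "\<And>\<phi>. \<phi> \<in> F \<Longrightarrow> unitary_character \<phi>" and "finite F"
    and on_H: "\<And>h. h \<in> H \<Longrightarrow> norm (\<Sum>\<phi>\<in>F. c \<phi> * \<phi> h) \<le> 1/4"
    and on_coset: "\<And>h. h \<in> H \<Longrightarrow> norm ((\<Sum>\<phi>\<in>F. c \<phi> * \<phi> (z + h)) - 1) \<le> 1/4"
  obtains \<phi> where "\<phi> \<in> F" "\<forall>h\<in>H. \<phi> h = 1" "\<phi> z \<noteq> 1"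
proof -
  have False if triv: "\<And>\<phi>. \<phi> \<in> F \<Longrightarrow> \<forall>h\<in>H. \<phi> h = 1 \<Longrightarrow> \<phi> z = 1"
  proof -
    define N where "N = {\<phi>\<in>F. \<exists>h\<in>H. \<phi> h \<noteq> 1}"
    \<comment> \<open>With this bound the nontrivial characters contribute at most 1/4 to the difference of two values.\<close>
    define \<delta> :: real where "\<delta> = 1 / (8 * (card F + 1))"
    define K :: "(complex \<times> 'a) set" where "K = {(0, 0), (1, z)}"
    have "\<delta> > 0" by (simp add: \<delta>_def add_nonneg_pos)
    have "\<exists>c'.
      (\<forall>y x h. (y, x) \<in> K \<longrightarrow> h \<in> H \<longrightarrow> norm ((\<Sum>\<phi>\<in>F. c' \<phi> * \<phi> (x + h)) - y) \<le> 1/4) \<and>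
      (\<forall>\<phi>\<in>N. norm (c' \<phi>) \<le> \<delta>) \<and> (\<forall>\<phi>. (\<forall>h\<in>H. \<phi> h = 1) \<longrightarrow> c' \<phi> = c \<phi>)"
      by (rule averaging_shrinks_coefficients[OF H F \<open>finite F\<close> _ _ _ \<open>\<delta> > 0\<close>])
        (use \<open>finite F\<close> on_H on_coset in \<open>auto simp: N_def K_def\<close>)
    then obtain c' where c': "\<And>y x h. (y, x) \<in> K \<Longrightarrow> h \<in> H \<Longrightarrow> norm ((\<Sum>\<phi>\<in>F. c' \<phi> * \<phi> (x + h)) - y) \<le> 1/4"
      "\<And>\<phi>. \<phi> \<in> N \<Longrightarrow> norm (c' \<phi>) \<le> \<delta>" by blast
    have "0 \<in> H" using H by (simp add: add_subgroup_def)
    define p where "p x = (\<Sum>\<phi>\<in>F. c' \<phi> * \<phi> x)" for x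
    have "norm (p 0) \<le> 1/4" "norm (p z - 1) \<le> 1/4"
      using c'(1)[of 0 0 0] c'(1)[of 1 z 0] \<open>0 \<in> H\<close> by (simp_all add: K_def p_def)
    moreover have "norm (p z - p 0) \<le> 1/4"
    proof -
      have "p z - p 0 = (\<Sum>\<phi>\<in>F. c' \<phi> * (\<phi> z - \<phi> 0))"
        by (simp add: p_def sum_subtractf right_diff_distrib)
      also have "norm \<dots> \<le> card F * (\<delta> * 2)"
      proof (rule sum_norm_bound)
        fix \<phi> assume "\<phi> \<in> F"
        note u = F[OF this]
        show "norm (c' \<phi> * (\<phi> z - \<phi> 0)) \<le> \<delta> * 2"
        proof (cases "\<phi> \<in> N")
          case True
          have "norm (\<phi> z - \<phi> 0) \<le> norm (\<phi> z) + norm (\<phi> 0)"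
            by (rule norm_triangle_ineq4)
          also have "\<dots> = 2" using u by (simp add: unitary_character_def)
          finally show ?thesis
            using c'(2)[OF True] \<open>\<delta> > 0\<close> by (simp add: norm_mult mult_mono)
        next
          case False
          then have "\<phi> z = 1" using \<open>\<phi> \<in> F\<close> triv by (auto simp: N_def)
          then show ?thesis using unitary_character_zero[OF u] \<open>\<delta> > 0\<close> by simp
        qed
      qed
      also have "\<dots> \<le> 1/4"
        by (simp add: \<delta>_def field_simps)
      finally show ?thesis .
    qed
    moreover have "norm (1::complex) \<le> norm (p 0) + norm (p z - p 0) + norm (p z - 1)"
    proof -
      have "norm ((p 0 + (p z - p 0)) - (p z - 1)) \<le> norm (p 0 + (p z - p 0)) + norm (p z - 1)"
        by (rule norm_triangle_ineq4)
      moreover have "norm (p 0 + (p z - p 0)) \<le> norm (p 0) + norm (p z - p 0)"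
        by (rule norm_triangle_ineq)
      ultimately show ?thesis by simp
    qed
    ultimately show False by simp
  qed
  with that show thesis by blast
qed

text \<open>
  The linear span, generated one summand at a time, so that closure under addition and multiplication
  follows by induction.
\<close>

inductive_set character_span :: "('a \<Rightarrow> complex) set \<Rightarrow> ('a \<Rightarrow> complex) set"
  for X :: "('a \<Rightarrow> complex) set" where
  zero: "(\<lambda>_. 0) \<in> character_span X"
| step: "\<phi> \<in> X \<Longrightarrow> p \<in> character_span X \<Longrightarrow> (\<lambda>x. c * \<phi> x + p x) \<in> character_span X"

lemma character_span_base: "\<phi> \<in> X \<Longrightarrow> (\<lambda>x. c * \<phi> x) \<in> character_span X"
  using character_span.step[OF _ character_span.zero] by simp

lemma character_span_add:
  assumes "p \<in> character_span X" "q \<in> character_span X"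
  shows "(\<lambda>x. p x + q x) \<in> character_span X"
  using assms(1)
proof induction
  case (step \<phi> p c)
  from character_span.step[OF step(1,3), of c] show ?case by (simp add: add.assoc)
qed (use assms in simp)

lemma character_span_mult:
  assumes "\<And>\<phi> \<phi>'. \<phi> \<in> X \<Longrightarrow> \<phi>' \<in> X \<Longrightarrow> (\<lambda>x. \<phi> x * \<phi>' x) \<in> X"
    and "p \<in> character_span X" "q \<in> character_span X"
  shows "(\<lambda>x. p x * q x) \<in> character_span X"
  using assms(2)
proof induction
  case zero
  then show ?case using character_span.zero by simp
next
  case (step \<phi> p c)
  have "(\<lambda>x. c * \<phi> x * q x) \<in> character_span X"
    using assms(3)
  proof induction
    case zero
    then show ?case using character_span.zero by simp
  next
    case (step \<phi>' q c')
    from character_span.step[OF assms(1)[OF \<open>\<phi> \<in> X\<close> step(1)] step(3), of "c * c'"]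
    show ?case by (simp add: algebra_simps)
  qed
  from character_span_add[OF this step(3)] show ?case by (simp add: algebra_simps)
qed

lemma character_span_finite_sum:
  assumes "p \<in> character_span X"
  shows "\<exists>F c. finite F \<and> F \<subseteq> X \<and> p = (\<lambda>x. \<Sum>\<phi>\<in>F. c \<phi> * \<phi> x)"
  using assms
proof induction
  case zero
  then show ?case by (intro exI[of _ "{}"]) auto
next
  case (step \<phi> p a)
  then obtain F c where F: "finite F" "F \<subseteq> X" "p = (\<lambda>x. \<Sum>\<phi>\<in>F. c \<phi> * \<phi> x)" by blast
  define c0 where "c0 \<psi> = (if \<psi> \<in> F then c \<psi> else 0)" for \<psi>
  define c' where "c' \<psi> = (if \<psi> = \<phi> then a else 0) + c0 \<psi>" for \<psi>
  have "a * \<phi> x + p x = (\<Sum>\<psi>\<in>insert \<phi> F. c' \<psi> * \<psi> x)" for x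
  proof -
    have "(\<Sum>\<psi>\<in>insert \<phi> F. c' \<psi> * \<psi> x)
      = (\<Sum>\<psi>\<in>insert \<phi> F. if \<psi> = \<phi> then a * \<psi> x else 0) + (\<Sum>\<psi>\<in>insert \<phi> F. c0 \<psi> * \<psi> x)"
      unfolding sum.distrib[symmetric] by (rule sum.cong) (auto simp: c'_def algebra_simps)
    also have "(\<Sum>\<psi>\<in>insert \<phi> F. c0 \<psi> * \<psi> x) = (\<Sum>\<psi>\<in>F. c \<psi> * \<psi> x)"
      by (rule sum.mono_neutral_cong_right) (use F in \<open>auto simp: c0_def\<close>)
    finally show ?thesis using F by (simp add: sum.delta)
  qed
  with F step show ?case
    by (intro exI[of _ "insert \<phi> F"] exI[of _ c']) auto
qed

text \<open>
  Real and imaginary parts of characters separate points, so the real functions in the span of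
  \<open>X\<close> satisfy the hypotheses of the Stone-Weierstrass theorem.  They therefore contain a function that
  is small on \<open>H\<close> and near 1 on the coset of \<open>z\<close>, to which averaging applies.
\<close>

theorem character_separates_closed_subgroup:
  fixes H :: "'a::{t2_space,ab_group_add} set" and X :: "('a \<Rightarrow> complex) set"
  assumes comp: "compact (UNIV :: 'a set)"
    and transl: "\<And>a. continuous_on UNIV (\<lambda>x::'a. x + a)"
    and unitary: "\<And>\<phi>. \<phi> \<in> X \<Longrightarrow> unitary_character \<phi>"
    and cont: "\<And>\<phi>. \<phi> \<in> X \<Longrightarrow> continuous_on UNIV \<phi>"
    and one: "(\<lambda>_. 1) \<in> X"
    and mult: "\<And>\<phi> \<phi>'. \<phi> \<in> X \<Longrightarrow> \<phi>' \<in> X \<Longrightarrow> (\<lambda>x. \<phi> x * \<phi>' x) \<in> X"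
    and cnj: "\<And>\<phi>. \<phi> \<in> X \<Longrightarrow> (\<lambda>x. cnj (\<phi> x)) \<in> X"
    and points: "\<And>x y. x \<noteq> y \<Longrightarrow> \<exists>\<phi>\<in>X. \<phi> x \<noteq> \<phi> y"
    and H: "closed H" "add_subgroup H" and z: "z \<notin> H"
  obtains \<phi> where "\<phi> \<in> X" "\<forall>h\<in>H. \<phi> h = 1" "\<phi> z \<noteq> 1"
proof -
  define R where "R = {f :: 'a \<Rightarrow> real. (\<lambda>x. complex_of_real (f x)) \<in> character_span X}"
  have cont_span: "continuous_on UNIV p" if "p \<in> character_span X" for p
    using that
  proof induction
    case (step \<phi> p c)
    then show ?case by (intro continuous_intros cont[OF step(1)])
  qed simp
  have ReR: "(\<lambda>x. Re (c * \<phi> x)) \<in> R" if "\<phi> \<in> X" for \<phi> c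
  proof -
    \<comment> \<open>The factor \<open>c\<close> is later taken to be 1 and \<open>- \<i>\<close>, which gives real and imaginary parts.\<close>
    have "complex_of_real (Re (c * \<phi> x)) = c / 2 * \<phi> x + cnj c / 2 * cnj (\<phi> x)" for x
      using complex_add_cnj[of "c * \<phi> x"] by (simp add: field_simps)
    then show ?thesis
      using character_span.step[OF that character_span_base[OF cnj[OF that], of "cnj c / 2"], of "c / 2"]
      by (simp add: R_def)
  qed
  interpret function_ring_on R UNIV
  proof
    show "compact (UNIV :: 'a set)" by (rule comp)
    show "continuous_on UNIV f" if "f \<in> R" for f
    proof -
      have "continuous_on UNIV (\<lambda>x. Re (complex_of_real (f x)))"
        using that by (intro continuous_intros cont_span) (auto simp: R_def)
      then show ?thesis by simp
    qed
    show "(\<lambda>x. f x + g x) \<in> R" if "f \<in> R" "g \<in> R" for f g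
      using that by (auto simp: R_def intro: character_span_add)
    show "(\<lambda>x. f x * g x) \<in> R" if "f \<in> R" "g \<in> R" for f g
      using that by (auto simp: R_def intro: character_span_mult mult)
    show "(\<lambda>_. c) \<in> R" for c
      using character_span_base[OF one, of "complex_of_real c"] by (simp add: R_def)
    show "\<exists>f\<in>R. f x \<noteq> f y" if "x \<noteq> y" for x y
    proof -
      obtain \<phi> where \<phi>: "\<phi> \<in> X" "\<phi> x \<noteq> \<phi> y" using points[OF \<open>x \<noteq> y\<close>] by (rule bexE)
      then consider "Re (1 * \<phi> x) \<noteq> Re (1 * \<phi> y)" | "Re (- \<i> * \<phi> x) \<noteq> Re (- \<i> * \<phi> y)"
        by (auto simp: complex_eq_iff)
      then show ?thesis
        by cases (rule bexI[OF _ ReR[OF \<phi>(1)]], assumption)+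
    qed
  qed
  define B where "B = {x. x - z \<in> H}"
  have "closed B"
  proof -
    have "continuous_on UNIV (\<lambda>x. x - z)" using transl[of "- z"] by simp
    from closed_vimage[OF H(1) this] show ?thesis by (simp add: B_def vimage_def)
  qed
  moreover have "H \<inter> B = {}"
  proof -
    have "z \<in> H" if "x \<in> H" "x - z \<in> H" for x
    proof -
      have "x + - (x - z) \<in> H" using that H(2) unfolding add_subgroup_def by blast
      then show ?thesis by simp
    qed
    with z show ?thesis by (auto simp: B_def)
  qed
  ultimately have "\<exists>f\<in>R. f ` UNIV \<subseteq> {0..1} \<and> (\<forall>x\<in>H. f x < 1/4) \<and> (\<forall>x\<in>B. f x > 1 - 1/4)"
    by (intro two) (simp_all add: H(1))
  then obtain f where f: "f \<in> R" "f ` UNIV \<subseteq> {0..1}" "\<forall>x\<in>H. f x < 1/4" "\<forall>x\<in>B. f x > 1 - 1/4"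
    by (elim bexE conjE)
  have "(\<lambda>x. complex_of_real (f x)) \<in> character_span X"
    using f(1) by (simp add: R_def)
  from character_span_finite_sum[OF this] obtain F c where F: "finite F" "F \<subseteq> X"
    "(\<lambda>x. complex_of_real (f x)) = (\<lambda>x. \<Sum>\<phi>\<in>F. c \<phi> * \<phi> x)"
    by (elim exE conjE)
  have f_eq: "(\<Sum>\<phi>\<in>F. c \<phi> * \<phi> x) = complex_of_real (f x)" for x
    using fun_cong[OF F(3)] by simp
  have f01: "0 \<le> f x" "f x \<le> 1" for x
    using subsetD[OF f(2) rangeI[of f x]] by simp_all
  obtain \<phi> where "\<phi> \<in> F" "\<forall>h\<in>H. \<phi> h = 1" "\<phi> z \<noteq> 1"
  proof (rule separation_by_averaging[OF H(2) _ F(1)])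
    show "\<And>\<phi>. \<phi> \<in> F \<Longrightarrow> unitary_character \<phi>" using F unitary by blast
    show "norm (\<Sum>\<phi>\<in>F. c \<phi> * \<phi> h) \<le> 1/4" if "h \<in> H" for h
    proof -
      have "f h < 1/4" using f(3) that by (rule bspec)
      then show ?thesis using f01[of h] by (simp add: f_eq)
    qed
    show "norm ((\<Sum>\<phi>\<in>F. c \<phi> * \<phi> (z + h)) - 1) \<le> 1/4" if "h \<in> H" for h
    proof -
      have "z + h \<in> B" using that by (simp add: B_def)
      then have "1 - 1/4 < f (z + h)" using f(4) by blast
      moreover have "norm (complex_of_real (f (z + h)) - 1) = \<bar>f (z + h) - 1\<bar>"
        by (metis norm_of_real of_real_1 of_real_diff)
      ultimately show ?thesis using f01[of "z + h"] by (simp add: f_eq)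
    qed
  qed
  with F that show thesis by blast
qed


section \<open>The torus and its characters\<close>

text \<open>
  Points of the torus are treated through their real lifts.  On integral vectors the pairing with a
  lift is well defined modulo the integers, and the characters are its exponentials, so the equation
  \<open>\<chi> = 1\<close> becomes integrality of a pairing.
\<close>

definition pairing :: "rat^'m \<Rightarrow> real^'m \<Rightarrow> real" where
  "pairing u s = (\<Sum>j\<in>UNIV. of_rat (u $ j) * s $ j)"

text \<open>
  The action of the transposed rational matrix on real vectors, which is adjoint to \<open>M\<close> under the
  pairing.
\<close>

definition adjoint_action :: "rat^'m^'n \<Rightarrow> real^'n \<Rightarrow> real^'m" where
  "adjoint_action M s = (\<chi> i. \<Sum>j\<in>UNIV. of_rat (M $ j $ i) * s $ j)"

lemma pairing_zero [simp]: "pairing 0 s = 0" "pairing u 0 = 0"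
  by (simp_all add: pairing_def)

lemma pairing_add_left: "pairing (u + v) s = pairing u s + pairing v s"
  by (simp add: pairing_def of_rat_add distrib_right sum.distrib)

lemma pairing_add_right: "pairing u (s + t) = pairing u s + pairing u t"
  by (simp add: pairing_def distrib_left sum.distrib)

lemma pairing_minus_left: "pairing (- u) s = - pairing u s"
  by (simp add: pairing_def of_rat_minus sum_negf)

lemma pairing_minus_right: "pairing u (- s) = - pairing u s"
  by (simp add: pairing_def sum_negf)

lemma pairing_diff_right: "pairing u (s - t) = pairing u s - pairing u t"
  using pairing_add_right[of u s "- t"] by (simp add: pairing_minus_right)

lemma pairing_scale_left: "pairing (c *s u) s = of_rat c * pairing u s"
  by (simp add: pairing_def of_rat_mult sum_distrib_left mult.assoc)

lemma pairing_scale_right: "pairing u (c *\<^sub>R s) = c * pairing u s"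
  by (simp add: pairing_def sum_distrib_left mult.assoc mult.left_commute)

lemma pairing_axis: "pairing (axis i 1) s = s $ i"
proof -
  have "pairing (axis i 1) s = (\<Sum>j\<in>UNIV. if j = i then s $ j else 0)"
    unfolding pairing_def by (rule sum.cong) (auto simp: axis_def)
  then show ?thesis by simp
qed

lemma pairing_mult: "pairing (M *v u) s = pairing u (adjoint_action M s)"
proof -
  have "pairing (M *v u) s = (\<Sum>j\<in>UNIV. \<Sum>i\<in>UNIV. of_rat (M $ j $ i) * of_rat (u $ i) * s $ j)"
    by (simp add: pairing_def matrix_vector_mult_def of_rat_sum of_rat_mult sum_distrib_right)
  also have "\<dots> = (\<Sum>i\<in>UNIV. \<Sum>j\<in>UNIV. of_rat (M $ j $ i) * of_rat (u $ i) * s $ j)"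
    by (rule sum.swap)
  also have "\<dots> = pairing u (adjoint_action M s)"
    by (simp add: pairing_def adjoint_action_def sum_distrib_left mult_ac)
  finally show ?thesis .
qed

lemma adjoint_action_add: "adjoint_action M (s + t) = adjoint_action M s + adjoint_action M t"
  by (simp add: adjoint_action_def vec_eq_iff distrib_left sum.distrib)

lemma adjoint_action_minus: "adjoint_action M (- s) = - adjoint_action M s"
  by (simp add: adjoint_action_def vec_eq_iff sum_negf)

lemma continuous_on_adjoint_action: "continuous_on UNIV (adjoint_action M)"
  unfolding adjoint_action_def by (intro continuous_intros)

lemma continuous_on_pairing: "continuous_on S (pairing u)"
  unfolding pairing_def[abs_def] by (intro continuous_intros)

lemma int_lattice_iff: "u \<in> int_lattice \<longleftrightarrow> (\<forall>i. u $ i \<in> \<int>)"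
proof
  assume "\<forall>i. u $ i \<in> \<int>"
  then have "u = rat_vec (\<chi> i. \<lfloor>u $ i\<rfloor>)" by (simp add: rat_vec_def vec_eq_iff)
  then show "u \<in> int_lattice" by (auto simp: int_lattice_def)
qed (auto simp: int_lattice_def rat_vec_def)

lemma int_lattice_closed:
  "0 \<in> int_lattice" "u \<in> int_lattice \<Longrightarrow> v \<in> int_lattice \<Longrightarrow> u + v \<in> int_lattice"
  "u \<in> int_lattice \<Longrightarrow> - u \<in> int_lattice" "axis i 1 \<in> int_lattice"
  "u \<in> int_lattice \<Longrightarrow> v \<in> int_lattice \<Longrightarrow> u - v \<in> int_lattice"
  "u \<in> int_lattice \<Longrightarrow> of_nat k *s u \<in> int_lattice"
  by (auto simp: int_lattice_iff axis_def)

lemma pairing_in_Ints: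
  assumes "u \<in> int_lattice" "\<And>i. s $ i \<in> \<int>"
  shows "pairing u s \<in> \<int>"
  unfolding pairing_def
proof (rule Ints_sum)
  fix j
  from assms(1) obtain k :: int where "u $ j = of_int k"
    by (auto simp: int_lattice_iff elim: Ints_cases)
  then show "of_rat (u $ j) * s $ j \<in> \<int>" using assms(2) by simp
qed

lemma torus_of_eq_iff: "torus_of s = torus_of t \<longleftrightarrow> (\<forall>i. s $ i - t $ i \<in> \<int>)"
  by (simp add: torus.abs_eq_iff torus_rel_def)

lemma torus_of_zero: "torus_of 0 = 0"
  by (simp add: zero_torus_def)

lemma torus_of_add: "torus_of (s + t) = torus_of s + torus_of t"
  by (simp add: plus_torus.abs_eq)

lemma torus_of_minus: "torus_of (- s) = - torus_of s"
  by (simp add: uminus_torus.abs_eq)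

lemma torus_cases: obtains s where "x = torus_of s"
  by (induction x rule: torus.abs_induct) blast

lemma pairing_torus_of_cong:
  assumes "u \<in> int_lattice" "torus_of s = torus_of s'"
  shows "pairing u s - pairing u s' \<in> \<int>"
  unfolding pairing_diff_right[symmetric]
  by (rule pairing_in_Ints) (use assms in \<open>auto simp: torus_of_eq_iff\<close>)

lemma torus_char_torus_of:
  "torus_char n (torus_of s) = exp (2 * of_real pi * \<i> * of_real (pairing (rat_vec n) s))"
  by (simp add: torus_char.abs_eq pairing_def rat_vec_def)

lemma exp_2pi_eq_1_iff: "exp (2 * of_real pi * \<i> * of_real r) = 1 \<longleftrightarrow> r \<in> \<int>"
proof -
  have "2 * pi * r = of_int (2 * n) * pi \<longleftrightarrow> r = of_int n" for n by auto
  then show ?thesis by (auto simp: exp_eq_1 Ints_def)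
qed

lemma torus_char_pair_eq_1_iff:
  "torus_char a (torus_of s) * torus_char b (torus_of t) = 1 \<longleftrightarrow>
   pairing (rat_vec a) s + pairing (rat_vec b) t \<in> \<int>"
proof -
  have "torus_char a (torus_of s) * torus_char b (torus_of t) =
    exp (2 * of_real pi * \<i> * of_real (pairing (rat_vec a) s + pairing (rat_vec b) t))"
    by (simp add: torus_char_torus_of exp_add[symmetric] distrib_left)
  then show ?thesis by (simp only: exp_2pi_eq_1_iff)
qed

lemma torus_char_zero: "torus_char n 0 = 1" "torus_char 0 x = 1"
proof -
  show "torus_char n 0 = 1"
    by (simp add: torus_of_zero[symmetric] torus_char_torus_of)
  show "torus_char 0 x = 1"
    by (cases x rule: torus_cases) (simp add: torus_char_torus_of pairing_def rat_vec_def)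
qed

lemma torus_char_add: "torus_char n (x + y) = torus_char n x * torus_char n y"
  by (cases x rule: torus_cases, cases y rule: torus_cases)
    (simp add: torus_of_add[symmetric] torus_char_torus_of pairing_add_right distrib_left exp_add)

lemma rat_vec_add: "rat_vec (a + b) = rat_vec a + rat_vec b"
  by (simp add: rat_vec_def vec_eq_iff)

lemma rat_vec_minus: "rat_vec (- a) = - rat_vec a"
  by (simp add: rat_vec_def vec_eq_iff)

lemma torus_char_add_left: "torus_char (a + b) x = torus_char a x * torus_char b x"
  by (cases x rule: torus_cases)
    (simp add: torus_char_torus_of rat_vec_add pairing_add_left distrib_left exp_add)

lemma cnj_torus_char: "cnj (torus_char a x) = torus_char (- a) x"
  by (cases x rule: torus_cases)
    (simp add: torus_char_torus_of exp_cnj rat_vec_minus pairing_minus_left)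

lemma norm_torus_char: "norm (torus_char a x) = 1"
  by (cases x rule: torus_cases) (simp add: torus_char_torus_of)

lemma continuous_on_torus_of: "continuous_on S torus_of"
proof -
  have "continuous_on UNIV torus_of"
    unfolding continuous_on_open_vimage[OF open_UNIV] by (simp add: open_torus_def)
  then show ?thesis by (rule continuous_on_subset) simp
qed

lemma continuous_on_torusI:
  assumes "continuous_on UNIV (\<lambda>s. f (torus_of s))"
  shows "continuous_on UNIV f"
  using assms unfolding continuous_on_open_vimage[OF open_UNIV]
  by (simp add: open_torus_def vimage_def)

lemma continuous_on_torus_char: "continuous_on S (torus_char n)"
proof -
  have "continuous_on UNIV (torus_char n)"
    by (rule continuous_on_torusI)
      (simp add: torus_char_torus_of, intro continuous_intros continuous_on_pairing)
  then show ?thesis by (rule continuous_on_subset) simp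
qed

lemma continuous_on_torus_translation: "continuous_on UNIV (\<lambda>x :: 'm::finite torus. x + a)"
proof (rule continuous_on_torusI)
  obtain t where a: "a = torus_of t" by (rule torus_cases)
  show "continuous_on UNIV (\<lambda>s. torus_of s + a)"
    unfolding a torus_of_add[symmetric]
    by (rule continuous_on_compose2[OF continuous_on_torus_of[of UNIV]]) (auto intro!: continuous_intros)
qed

lemma rat_vec_axis: "rat_vec (axis i 1) = axis i 1"
  by (simp add: rat_vec_def axis_def vec_eq_iff)

lemma torus_char_separates_points:
  assumes "x \<noteq> y" obtains n where "torus_char n x \<noteq> torus_char n y"
proof -
  obtain s t where st: "x = torus_of s" "y = torus_of t" by (metis torus_cases)
  with assms obtain i where i: "s $ i - t $ i \<notin> \<int>" by (auto simp: torus_of_eq_iff)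
  have "torus_char (axis i 1) (torus_of s + torus_of (- t)) * torus_char 0 (torus_of 0) \<noteq> 1"
    unfolding torus_of_add[symmetric] torus_char_pair_eq_1_iff
    using i by (simp add: rat_vec_axis pairing_axis)
  then have "torus_char (axis i 1) x * torus_char (axis i 1) (- y) \<noteq> 1"
    unfolding torus_char_add torus_of_minus st by (simp add: torus_char_zero)
  moreover have "torus_char (axis i 1) y * torus_char (axis i 1) (- y) = 1"
    by (simp add: torus_char_add[symmetric] torus_char_zero)
  ultimately show thesis using that by metis
qed

text \<open>
  The torus is Hausdorff because its continuous characters separate points.
\<close>

instance torus :: (finite) t2_space
proof
  fix x y :: "'a torus" assume "x \<noteq> y"
  then obtain n where n: "torus_char n x \<noteq> torus_char n y" by (rule torus_char_separates_points)
  from hausdorff[OF n] obtain U V where UV: "open U" "open V" "torus_char n x \<in> U" "torus_char n y \<in> V" "U \<inter> V = {}"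
    by (elim exE conjE)
  have "open (torus_char n -` U)" "open (torus_char n -` V)"
    using continuous_on_torus_char[of UNIV n] UV
    unfolding continuous_on_open_vimage[OF open_UNIV] by simp_all
  with UV show "\<exists>U V. open U \<and> open V \<and> x \<in> U \<and> y \<in> V \<and> U \<inter> V = {}"
    by (intro exI[of _ "torus_char n -` U"] exI[of _ "torus_char n -` V"]) auto
qed

lemma compact_torus: "compact (UNIV :: 'm::finite torus set)"
proof -
  have "x \<in> torus_of ` cbox 0 (\<chi> i. 1)" for x :: "'m torus"
  proof -
    obtain s where s: "x = torus_of s" by (rule torus_cases)
    define t :: "real^'m" where "t = (\<chi> i. frac (s $ i))"
    have "torus_of t = x"
      by (simp add: s t_def torus_of_eq_iff frac_def)
    moreover have "t \<in> cbox 0 (\<chi> i. 1)"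
      by (simp add: mem_box_cart t_def frac_lt_1 less_imp_le)
    ultimately show ?thesis by blast
  qed
  then have "(UNIV :: 'm torus set) = torus_of ` cbox 0 (\<chi> i. 1)"
    by (intro equalityI subsetI) simp_all
  then show ?thesis
    using compact_continuous_image[OF continuous_on_torus_of compact_cbox] by metis
qed

lemma compact_torus_pair: "compact (UNIV :: ('m::finite torus \<times> 'n::finite torus) set)"
  using compact_Times[OF compact_torus compact_torus] by (simp add: UNIV_Times_UNIV)

definition pair_char :: "int^'m::finite \<Rightarrow> int^'n::finite \<Rightarrow> 'm torus \<times> 'n torus \<Rightarrow> complex" where
  "pair_char a b = (\<lambda>(x, y). torus_char a x * torus_char b y)"

lemma continuous_on_pair_char: "continuous_on S (pair_char a b)"
  unfolding pair_char_def case_prod_unfold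
  by (intro continuous_intros continuous_on_compose2[OF continuous_on_torus_char[of UNIV]]) auto

lemma unitary_character_pair_char: "unitary_character (pair_char a b)"
  by (simp add: unitary_character_def pair_char_def split: prod.split)
    (simp add: torus_char_add norm_mult norm_torus_char)

theorem closed_subgroup_separation:
  fixes H :: "('m::finite torus \<times> 'n::finite torus) set"
  assumes "closed H" "add_subgroup H" "z \<notin> H"
  obtains a b where "\<forall>h\<in>H. pair_char a b h = 1" "pair_char a b z \<noteq> 1"
proof -
  define X where "X = {pair_char a b | (a :: int^'m) (b :: int^'n). True}"
  obtain \<phi> where "\<phi> \<in> X" "\<forall>h\<in>H. \<phi> h = 1" "\<phi> z \<noteq> 1"
  proof (rule character_separates_closed_subgroup[where H = H and z = z and X = X])
    show "continuous_on UNIV (\<lambda>x. x + a)" for a :: "'m torus \<times> 'n torus"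
    proof -
      have "(\<lambda>x. x + a) = (\<lambda>x. (fst x + fst a, snd x + snd a))"
        by (simp add: fun_eq_iff plus_prod_def)
      moreover have "continuous_on UNIV (\<lambda>x :: 'm torus \<times> 'n torus. (fst x + fst a, snd x + snd a))"
        by (intro continuous_on_Pair
            continuous_on_compose2[OF continuous_on_torus_translation continuous_on_fst[OF continuous_on_id]]
            continuous_on_compose2[OF continuous_on_torus_translation continuous_on_snd[OF continuous_on_id]]) auto
      ultimately show ?thesis by (simp only:)
    qed
    show "(\<lambda>_. 1) \<in> X"
      unfolding X_def mem_Collect_eq
      by (intro exI[of _ 0]) (auto simp: pair_char_def torus_char_zero)
    show "(\<lambda>x. \<phi> x * \<phi>' x) \<in> X" if "\<phi> \<in> X" "\<phi>' \<in> X" for \<phi> \<phi>'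
    proof -
      from that obtain a b a' b' where "\<phi> = pair_char a b" "\<phi>' = pair_char a' b'"
        unfolding X_def by blast
      then have "(\<lambda>x. \<phi> x * \<phi>' x) = pair_char (a + a') (b + b')"
        by (auto simp: pair_char_def torus_char_add_left)
      then show ?thesis unfolding X_def by blast
    qed
    show "(\<lambda>x. cnj (\<phi> x)) \<in> X" if "\<phi> \<in> X" for \<phi>
    proof -
      from that obtain a b where "\<phi> = pair_char a b" unfolding X_def by blast
      then have "(\<lambda>x. cnj (\<phi> x)) = pair_char (- a) (- b)"
        by (auto simp: pair_char_def cnj_torus_char)
      then show ?thesis unfolding X_def by blast
    qed
    show "\<exists>\<phi>\<in>X. \<phi> x \<noteq> \<phi> y" if "x \<noteq> y" for x y
    proof (cases "fst x = fst y")
      case True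
      with that have "snd x \<noteq> snd y" by (auto simp: prod_eq_iff)
      then obtain b where "torus_char b (snd x) \<noteq> torus_char b (snd y)"
        by (rule torus_char_separates_points)
      then have "pair_char 0 b x \<noteq> pair_char 0 b y"
        by (simp add: pair_char_def case_prod_unfold torus_char_zero)
      then show ?thesis unfolding X_def by blast
    next
      case False
      then obtain a where "torus_char a (fst x) \<noteq> torus_char a (fst y)"
        by (rule torus_char_separates_points)
      then have "pair_char a 0 x \<noteq> pair_char a 0 y"
        by (simp add: pair_char_def case_prod_unfold torus_char_zero)
      then show ?thesis unfolding X_def by blast
    qed
    show "unitary_character \<phi>" "continuous_on UNIV \<phi>" if "\<phi> \<in> X" for \<phi>
      using that unfolding X_def
      by (blast intro: unitary_character_pair_char continuous_on_pair_char)+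
  qed (use assms compact_torus_pair in \<open>simp_all\<close>)
  with that show thesis unfolding X_def by blast
qed

section \<open>Annihilators and polars\<close>

text \<open>
  On real lifts, triviality of a character becomes integrality of pairings.
\<close>

lemma annihilator_iff:
  "(u, v) \<in> annihilator P \<longleftrightarrow> u \<in> int_lattice \<and> v \<in> int_lattice \<and>
    (\<forall>s t. (torus_of s, torus_of t) \<in> P \<longrightarrow> pairing u s + pairing v t \<in> \<int>)"
proof -
  have "(\<forall>(x, y)\<in>P. torus_char a x * torus_char b y = 1) \<longleftrightarrow>
    (\<forall>s t. (torus_of s, torus_of t) \<in> P \<longrightarrow> pairing (rat_vec a) s + pairing (rat_vec b) t \<in> \<int>)"
    for a b :: "int^'a"
  proof
    assume R: "\<forall>s t. (torus_of s, torus_of t) \<in> P \<longrightarrow>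
      pairing (rat_vec a) s + pairing (rat_vec b) t \<in> \<int>"
    show "\<forall>(x, y)\<in>P. torus_char a x * torus_char b y = 1"
    proof (intro ballI, clarify)
      fix x y assume "(x, y) \<in> P"
      moreover obtain s t where "x = torus_of s" "y = torus_of t" by (metis torus_cases)
      ultimately show "torus_char a x * torus_char b y = 1"
        using R by (simp add: torus_char_pair_eq_1_iff)
    qed
  qed (auto simp: torus_char_pair_eq_1_iff[symmetric])
  then show ?thesis
    unfolding annihilator_def int_lattice_def mem_Collect_eq prod.inject by blast
qed

text \<open>
  A closed subgroup contains every point that its annihilator kills, by the separation theorem.
\<close>

lemma mem_closed_subgroupI:
  assumes "closed P" "add_subgroup P"
    and ann: "\<And>u v. (u, v) \<in> annihilator P \<Longrightarrow> pairing u s + pairing v t \<in> \<int>"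
  shows "(torus_of s, torus_of t) \<in> P"
proof (rule ccontr)
  assume "(torus_of s, torus_of t) \<notin> P"
  then obtain a b where ab: "\<forall>h\<in>P. pair_char a b h = 1" "pair_char a b (torus_of s, torus_of t) \<noteq> 1"
    by (rule closed_subgroup_separation[OF assms(1,2)])
  then have "\<forall>(x, y)\<in>P. torus_char a x * torus_char b y = 1"
    by (auto simp: pair_char_def)
  then have "(rat_vec a, rat_vec b) \<in> annihilator P"
    unfolding annihilator_def by (intro CollectI exI[of _ a] exI[of _ b] conjI refl)
  from ann[OF this] ab(2) show False
    by (simp add: pair_char_def torus_char_pair_eq_1_iff)
qed

lemma annihilator_inject:
  assumes "closed P" "add_subgroup P" "closed P'" "add_subgroup P'" "annihilator P = annihilator P'"
  shows "P = P'"
proof -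
  have sub: "P \<subseteq> P'" if "closed P'" "add_subgroup P'" "annihilator P = annihilator P'"
    for P P' :: "('a torus \<times> 'a torus) set"
  proof safe
    fix x y assume "(x, y) \<in> P"
    moreover obtain s t where st: "x = torus_of s" "y = torus_of t" by (metis torus_cases)
    ultimately have "pairing u s + pairing v t \<in> \<int>" if "(u, v) \<in> annihilator P'" for u v
      using that unfolding \<open>annihilator P = annihilator P'\<close>[symmetric] annihilator_iff by blast
    then show "(x, y) \<in> P'"
      unfolding st by (rule mem_closed_subgroupI[OF that(1,2)])
  qed
  show ?thesis
    using sub[of P' P] sub[of P P'] assms by simp
qed

text \<open>
  The joint kernel of the characters in \<open>A\<close>.
\<close>

definition polar :: "((rat^'m::finite) \<times> (rat^'m)) set \<Rightarrow> ('m torus \<times> 'm torus) set" where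
  "polar A = {(torus_of s, torus_of t) | s t. \<forall>(u, v)\<in>A. pairing u s + pairing v t \<in> \<int>}"

lemma polar_iff:
  assumes "A \<subseteq> int_lattice \<times> int_lattice"
  shows "(torus_of s, torus_of t) \<in> polar A \<longleftrightarrow> (\<forall>(u, v)\<in>A. pairing u s + pairing v t \<in> \<int>)"
proof
  assume "(torus_of s, torus_of t) \<in> polar A"
  then obtain s' t' where st: "torus_of s = torus_of s'" "torus_of t = torus_of t'"
    and A: "\<forall>(u, v)\<in>A. pairing u s' + pairing v t' \<in> \<int>" unfolding polar_def by blast
  show "\<forall>(u, v)\<in>A. pairing u s + pairing v t \<in> \<int>"
  proof (intro ballI, clarify)
    fix u v assume uv: "(u, v) \<in> A"
    have "pairing u s - pairing u s' \<in> \<int>" "pairing v t - pairing v t' \<in> \<int>"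
      using uv assms st by (auto intro!: pairing_torus_of_cong)
    moreover have "pairing u s' + pairing v t' \<in> \<int>" using A uv by blast
    ultimately have "((pairing u s - pairing u s') + (pairing v t - pairing v t')) +
        (pairing u s' + pairing v t') \<in> \<int>"
      by (metis Ints_add)
    then show "pairing u s + pairing v t \<in> \<int>" by (simp add: algebra_simps)
  qed
qed (auto simp: polar_def)

lemma closed_polar:
  assumes "A \<subseteq> int_lattice \<times> int_lattice" shows "closed (polar A)"
proof -
  define B where "B = {(a, b). (rat_vec a, rat_vec b) \<in> A}"
  have "polar A = (\<Inter>(a, b)\<in>B. {z. pair_char a b z = 1})"
  proof (intro set_eqI)
    fix z :: "'a torus \<times> 'a torus"
    obtain s t where z: "z = (torus_of s, torus_of t)" by (metis torus_cases surj_pair)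
    have "z \<in> polar A \<longleftrightarrow> (\<forall>(a, b)\<in>B. pairing (rat_vec a) s + pairing (rat_vec b) t \<in> \<int>)"
    proof
      assume "z \<in> polar A"
      then show "\<forall>(a, b)\<in>B. pairing (rat_vec a) s + pairing (rat_vec b) t \<in> \<int>"
        unfolding z polar_iff[OF assms] B_def by auto
    next
      assume R: "\<forall>(a, b)\<in>B. pairing (rat_vec a) s + pairing (rat_vec b) t \<in> \<int>"
      show "z \<in> polar A"
        unfolding z polar_iff[OF assms]
      proof (intro ballI, clarify)
        fix u v assume uv: "(u, v) \<in> A"
        then obtain a b where "u = rat_vec a" "v = rat_vec b"
          using assms by (auto simp: int_lattice_def)
        with uv R show "pairing u s + pairing v t \<in> \<int>" by (auto simp: B_def)
      qed
    qed
    then show "z \<in> polar A \<longleftrightarrow> z \<in> (\<Inter>(a, b)\<in>B. {z. pair_char a b z = 1})"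
      by (auto simp: z pair_char_def torus_char_pair_eq_1_iff)
  qed
  moreover have "closed {z. pair_char a b z = 1}" for a b :: "int^'a"
    by (rule closed_Collect_eq) (auto intro: continuous_on_pair_char)
  ultimately show ?thesis by auto
qed

lemma add_subgroup_polar:
  fixes A :: "((rat^'m::finite) \<times> (rat^'m)) set"
  assumes "A \<subseteq> int_lattice \<times> int_lattice" shows "add_subgroup (polar A)"
  unfolding add_subgroup_def
proof (intro conjI ballI)
  have "(torus_of 0, torus_of 0) \<in> polar A"
    unfolding polar_iff[OF assms] by auto
  then show "0 \<in> polar A" by (simp add: torus_of_zero zero_prod_def)
next
  fix x y assume xy: "x \<in> polar A" "y \<in> polar A"
  obtain s t s' t' where st: "x = (torus_of s, torus_of t)" "y = (torus_of s', torus_of t')"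
    by (metis torus_cases surj_pair)
  have "(torus_of (s + s'), torus_of (t + t')) \<in> polar A"
    unfolding polar_iff[OF assms]
  proof (intro ballI, clarify)
    fix u v assume "(u, v) \<in> A"
    then have "(pairing u s + pairing v t) + (pairing u s' + pairing v t') \<in> \<int>"
      using xy unfolding st polar_iff[OF assms] by (intro Ints_add[of "_ + _" "_ + _"]) auto
    then show "pairing u (s + s') + pairing v (t + t') \<in> \<int>"
      by (simp add: pairing_add_right algebra_simps)
  qed
  then show "x + y \<in> polar A" by (simp add: st torus_of_add)
next
  fix x assume x: "x \<in> polar A"
  obtain s t where st: "x = (torus_of s, torus_of t)" by (metis torus_cases surj_pair)
  have "(torus_of (- s), torus_of (- t)) \<in> polar A"
    unfolding polar_iff[OF assms]
  proof (intro ballI, clarify)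
    fix u v assume "(u, v) \<in> A"
    then have "- (pairing u s + pairing v t) \<in> \<int>"
      using x unfolding st polar_iff[OF assms] by (intro Ints_minus) blast
    then show "pairing u (- s) + pairing v (- t) \<in> \<int>"
      by (simp add: pairing_minus_right)
  qed
  then show "- x \<in> polar A" by (simp add: st torus_of_minus)
qed


section \<open>Lattices of finite index\<close>

lemma add_subgroup_int_multiple:
  fixes f :: "int \<Rightarrow> 'a::ab_group_add"
  assumes H: "add_subgroup H" and add: "\<And>i j. f (i + j) = f i + f j" and one: "f 1 \<in> H"
  shows "f k \<in> H"
proof (induction k rule: int_induct[where k = 0])
  case base
  have "f 0 = 0" using add[of 0 0] by simp
  then show ?case using H by (simp add: add_subgroup_def)
next
  case (step1 i)
  then show ?case using H one by (simp add: add add_subgroup_def)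
next
  case (step2 i)
  have "f (i - 1) = f i + - f 1" using add[of "i - 1" 1] by simp
  moreover have "f i + - f 1 \<in> H"
    using step2(2) H one unfolding add_subgroup_def by blast
  ultimately show ?case by simp
qed

lemma add_subgroup_int_scale:
  fixes L :: "(rat^'m) set"
  assumes "add_subgroup L" "v \<in> L" shows "of_int k *s v \<in> L"
  by (rule add_subgroup_int_multiple[where f = "\<lambda>k. of_int k *s v"])
    (use assms in \<open>simp_all add: vec.scale_left_distrib\<close>)

lemma add_subgroup_nat_scale:
  fixes L :: "(rat^'m) set"
  assumes "add_subgroup L" "v \<in> L" shows "of_nat k *s v \<in> L"
  using add_subgroup_int_scale[OF assms, of "int k"] by simp

lemma coset_eq_iff:
  fixes L :: "'a::ab_group_add set"
  assumes L: "add_subgroup L"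
  shows "(+) a ` L = (+) b ` L \<longleftrightarrow> a - b \<in> L"
proof
  assume eq: "(+) a ` L = (+) b ` L"
  have "a \<in> (+) a ` L" using L by (auto simp: add_subgroup_def image_iff)
  then obtain l where "l \<in> L" "a = b + l" unfolding eq by blast
  then show "a - b \<in> L" by simp
next
  assume ab: "a - b \<in> L"
  have sub: "(+) a ` L \<subseteq> (+) b ` L" if "a - b \<in> L" for a b
  proof safe
    fix l assume "l \<in> L"
    with that L have "(a - b) + l \<in> L" unfolding add_subgroup_def by blast
    moreover have "a + l = b + ((a - b) + l)" by simp
    ultimately show "a + l \<in> (+) b ` L" by blast
  qed
  have "- (a - b) \<in> L" using ab L unfolding add_subgroup_def by blast
  then have "b - a \<in> L" by simp
  with sub[OF ab] sub[of b a] show "(+) a ` L = (+) b ` L" by blast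
qed

lemma finite_residue_vectors: "finite {r :: int^'m::finite. \<forall>i. r $ i \<in> {0..<N}}"
proof -
  have "{r :: int^'m. \<forall>i. r $ i \<in> {0..<N}} \<subseteq> vec_lambda ` (PiE UNIV (\<lambda>_. {0..<N}))"
  proof
    fix r :: "int^'m" assume "r \<in> {r. \<forall>i. r $ i \<in> {0..<N}}"
    then have "vec_nth r \<in> PiE UNIV (\<lambda>_. {0..<N})" by auto
    moreover have "r = vec_lambda (vec_nth r)" by simp
    ultimately show "r \<in> vec_lambda ` (PiE UNIV (\<lambda>_. {0..<N}))" by blast
  qed
  then show ?thesis
    by (rule finite_subset) (intro finite_imageI finite_PiE; simp)
qed

text \<open>
  Fibres of correspondences and subgroups \<open>\<Lambda> / N\<close> of the torus are finite because they consist
  of \<open>N\<close>-torsion points, which are represented by the vectors \<open>r / N\<close> with residues \<open>r\<close>.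
\<close>

lemma finite_torsion_points:
  assumes "N > 0"
  shows "finite {torus_of s :: 'm::finite torus | s. \<forall>i. of_nat N * s $ i \<in> \<int>}"
proof (rule finite_subset)
  let ?R = "{r :: int^'m. \<forall>i. r $ i \<in> {0..<int N}}"
  show "finite ((\<lambda>r. torus_of (\<chi> i. of_int (r $ i) / of_nat N)) ` ?R)"
    by (intro finite_imageI finite_residue_vectors)
  show "{torus_of s :: 'm torus | s. \<forall>i. of_nat N * s $ i \<in> \<int>}
      \<subseteq> (\<lambda>r. torus_of (\<chi> i. of_int (r $ i) / of_nat N)) ` ?R"
  proof safe
    fix s :: "real^'m" assume s: "\<forall>i. of_nat N * s $ i \<in> \<int>"
    define k where "k i = \<lfloor>of_nat N * s $ i\<rfloor>" for i
    have k: "of_nat N * s $ i = of_int (k i)" for i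
    proof -
      have "of_nat N * s $ i \<in> \<int>" using s by (rule spec)
      then obtain z where "of_nat N * s $ i = of_int z" by (rule Ints_cases)
      then show ?thesis unfolding k_def by (simp only: floor_of_int)
    qed
    define r :: "int^'m" where "r = (\<chi> i. k i mod int N)"
    have "s $ i - of_int (r $ i) / of_nat N \<in> \<int>" for i
    proof -
      have "k i = int N * (k i div int N) + r $ i" by (simp add: r_def)
      from arg_cong[OF this, of real_of_int]
      have "real_of_int (k i) = of_nat N * of_int (k i div int N) + of_int (r $ i)"
        by (simp only: of_int_add of_int_mult of_int_of_nat_eq)
      then have "of_nat N * (s $ i - of_int (r $ i) / of_nat N) = of_nat N * of_int (k i div int N)"
        using assms k[of i] by (simp add: right_diff_distrib)
      then have "s $ i - of_int (r $ i) / of_nat N = of_int (k i div int N)"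
        using assms by simp
      then show ?thesis by simp
    qed
    then have "torus_of s = torus_of (\<chi> i. of_int (r $ i) / of_nat N)"
      by (simp add: torus_of_eq_iff)
    moreover have "r \<in> ?R" using assms by (simp add: r_def)
    ultimately show "torus_of s \<in> (\<lambda>r. torus_of (\<chi> i. of_int (r $ i) / of_nat N)) ` ?R"
      by blast
  qed
qed

text \<open>
  A lattice has finite index iff it contains \<open>N \<int>\<^sup>m\<close> for some positive \<open>N\<close>.  If there are \<open>c\<close>
  cosets, two of the multiples \<open>0 v, \<dots>, c v\<close> lie in the same one, so \<open>j v \<in> L\<close> with \<open>1 \<le> j \<le> c\<close>,
  and \<open>N = c!\<close> serves all \<open>v\<close> at once.  Conversely, every coset is represented by a vector of residues
  modulo \<open>N\<close>.
\<close>

lemma finite_index_iff: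
  fixes L :: "(rat^'m::finite) set"
  shows "L \<in> finite_index_subgroups \<longleftrightarrow> add_subgroup L \<and> L \<subseteq> int_lattice \<and>
    (\<exists>N>0. \<forall>v\<in>int_lattice. of_nat N *s v \<in> L)"
proof -
  let ?C = "{(+) v ` L | v. v \<in> int_lattice}"
  have "\<exists>N>0. \<forall>v\<in>int_lattice. of_nat N *s v \<in> L" if L: "add_subgroup L" and fin: "finite ?C"
  proof (intro exI[of _ "fact (card ?C)"] conjI ballI)
    fix v :: "rat^'m" assume v: "v \<in> int_lattice"
    define coset where "coset k = (+) (of_nat k *s v) ` L" for k
    have "\<not> inj_on coset {0..card ?C}"
    proof
      assume inj: "inj_on coset {0..card ?C}"
      have "card (coset ` {0..card ?C}) \<le> card ?C"
        using v by (intro card_mono fin) (auto simp: coset_def intro: int_lattice_closed)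
      with card_image[OF inj] show False by simp
    qed
    then obtain i l where il: "i \<le> card ?C" "l \<le> card ?C" "coset i = coset l" "i \<noteq> l"
      unfolding inj_on_def by auto
    define j k where "j = min i l" and "k = max i l"
    have jk: "j < k" "k \<le> card ?C" "coset k = coset j"
      using il by (auto simp: j_def k_def min_def max_def)
    from jk(3) have "of_nat k *s v - of_nat j *s v \<in> L" unfolding coset_def coset_eq_iff[OF L] .
    moreover have "of_nat k *s v - of_nat j *s v = of_nat (k - j) *s v"
      using jk by (simp add: of_nat_diff vec.scale_left_diff_distrib)
    ultimately have kj: "of_nat (k - j) *s v \<in> L" by simp
    have "k - j dvd fact (card ?C)" using jk by (intro dvd_fact) auto
    then obtain q where "fact (card ?C) = (k - j) * q" by (rule dvdE)
    then have "of_nat (fact (card ?C)) *s v = of_nat q *s (of_nat (k - j) *s v)"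
      by (simp only: of_nat_mult vec.scale_scale mult.commute)
    then show "of_nat (fact (card ?C)) *s v \<in> L"
      using add_subgroup_nat_scale[OF L kj] by (simp only:)
  qed simp
  moreover have "finite ?C" if L: "add_subgroup L" and N: "N > 0" "\<forall>v\<in>int_lattice. of_nat N *s v \<in> L"
    for N :: nat
  proof (rule finite_subset)
    let ?R = "{r :: int^'m. \<forall>i. r $ i \<in> {0..<int N}}"
    show "finite ((\<lambda>r. (+) (rat_vec r) ` L) ` ?R)"
      by (intro finite_imageI finite_residue_vectors)
    show "?C \<subseteq> (\<lambda>r. (+) (rat_vec r) ` L) ` ?R"
    proof safe
      fix v :: "rat^'m" assume "v \<in> int_lattice"
      then obtain n where n: "v = rat_vec n" by (auto simp: int_lattice_def)
      define r :: "int^'m" where "r = (\<chi> i. n $ i mod int N)"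
      define q :: "int^'m" where "q = (\<chi> i. n $ i div int N)"
      have nqr: "(of_int (n $ i) :: rat) = of_nat N * of_int (q $ i) + of_int (r $ i)" for i
      proof -
        have "n $ i = int N * q $ i + r $ i" by (simp add: r_def q_def)
        from arg_cong[OF this, of "of_int :: int \<Rightarrow> rat"] show ?thesis
          by (simp only: of_int_add of_int_mult of_int_of_nat_eq)
      qed
      have "v - rat_vec r = of_nat N *s rat_vec q"
        unfolding n by (simp add: vec_eq_iff rat_vec_def nqr)
      moreover have "rat_vec q \<in> int_lattice" by (simp add: int_lattice_def)
      ultimately have "v - rat_vec r \<in> L" using N by simp
      then have "(+) v ` L = (+) (rat_vec r) ` L" by (simp add: coset_eq_iff[OF L])
      moreover have "r \<in> ?R" using N by (simp add: r_def)
      ultimately show "(+) v ` L \<in> (\<lambda>r. (+) (rat_vec r) ` L) ` ?R" by blast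
    qed
  qed
  ultimately show ?thesis unfolding finite_index_subgroups_def by blast
qed

lemma common_denominator:
  fixes S :: "rat set" assumes "finite S"
  shows "\<exists>d>0. \<forall>r\<in>S. of_nat d * r \<in> \<int>"
  using assms
proof (induction S)
  case (insert r S)
  then obtain d where d: "d > 0" "\<forall>r\<in>S. of_nat d * r \<in> \<int>" by blast
  obtain a b where ab: "quotient_of r = (a, b)" by fastforce
  then have b: "b > 0" "r = of_int a / of_int b"
    by (simp_all add: quotient_of_denom_pos quotient_of_div)
  have "of_nat (nat b) * r = of_int a" using b by simp
  then have "of_nat (d * nat b) * r \<in> \<int>"
    by (simp add: mult.assoc)
  moreover have "of_nat (d * nat b) * r' \<in> \<int>" if "r' \<in> S" for r'
  proof -
    have "of_nat (d * nat b) * r' = of_nat (nat b) * (of_nat d * r')"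
      by (simp only: of_nat_mult mult_ac)
    then show ?thesis using d that by (metis Ints_mult Ints_of_nat)
  qed
  ultimately show ?case using d b by (intro exI[of _ "d * nat b"]) auto
qed auto

lemma vector_denominator:
  fixes v :: "rat^'m::finite"
  obtains d :: nat where "d > 0" "of_nat d *s v \<in> int_lattice"
  using common_denominator[of "range (vec_nth v)"] by (auto simp: int_lattice_iff)

lemma matrix_denominator:
  fixes M :: "rat^'m::finite^'n::finite"
  obtains d :: nat where "d > 0" "\<And>v. v \<in> int_lattice \<Longrightarrow> of_nat d *s (M *v v) \<in> int_lattice"
proof -
  obtain d :: nat where d: "d > 0" "\<forall>r\<in>range (\<lambda>(i, j). M $ i $ j). of_nat d * r \<in> \<int>"
    using common_denominator[of "range (\<lambda>(i, j). M $ i $ j)"] by auto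
  have "of_nat d *s (M *v v) \<in> int_lattice" if v: "v \<in> int_lattice" for v
    unfolding int_lattice_iff
  proof
    fix i
    have "of_nat d * M $ i $ j \<in> \<int>" "v $ j \<in> \<int>" for j
      using d v by (auto simp: int_lattice_iff)
    then have "(\<Sum>j\<in>UNIV. (of_nat d * M $ i $ j) * v $ j) \<in> \<int>"
      by (intro Ints_sum) (rule Ints_mult)
    then show "(of_nat d *s (M *v v)) $ i \<in> \<int>"
      by (simp add: matrix_vector_mult_def sum_distrib_left mult.assoc)
  qed
  with d that show thesis by blast
qed

text \<open>
  The product of exponents for the standard basis vectors serves all of \<open>\<int>\<^sup>m\<close>.
\<close>

lemma multiples_of_lattice:
  fixes L :: "(rat^'m::finite) set"
  assumes L: "add_subgroup L" and mult: "\<And>v. \<exists>k>0. of_nat k *s v \<in> L"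
  shows "\<exists>N>0. \<forall>v\<in>int_lattice. of_nat N *s v \<in> L"
proof -
  have "\<forall>i. \<exists>k>0. of_nat k *s axis i 1 \<in> L" using mult by blast
  from choice[OF this] obtain k where k: "\<And>i. k i > 0" "\<And>i. of_nat (k i) *s axis i 1 \<in> L"
    by blast
  define N where "N = (\<Prod>i\<in>UNIV. k i)"
  have axis: "of_nat N *s axis i 1 \<in> L" for i
  proof -
    have "N = (\<Prod>j\<in>UNIV - {i}. k j) * k i"
      unfolding N_def by (subst prod.remove[of _ i]) auto
    then have "of_nat N *s axis i (1 :: rat) = of_nat (\<Prod>j\<in>UNIV - {i}. k j) *s (of_nat (k i) *s axis i 1)"
      by (simp only: of_nat_mult vec.scale_scale)
    then show ?thesis using add_subgroup_nat_scale[OF L k(2)] by (simp only:)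
  qed
  have "of_nat N *s v \<in> L" if v: "v \<in> int_lattice" for v
  proof -
    have sum: "(\<Sum>i\<in>I. f i) \<in> L" if "\<And>i. f i \<in> L" "finite I" for f :: "'m \<Rightarrow> rat^'m" and I
      using that(2) by induction (use L that(1) in \<open>auto simp: add_subgroup_def\<close>)
    have "v $ i *s (of_nat N *s axis i 1) \<in> L" for i
    proof -
      obtain z where "v $ i = of_int z" using v by (auto simp: int_lattice_iff elim: Ints_cases)
      then show ?thesis using add_subgroup_int_scale[OF L axis] by simp
    qed
    then have "(\<Sum>i\<in>UNIV. v $ i *s (of_nat N *s axis i 1)) \<in> L" by (rule sum) simp
    also have "(\<Sum>i\<in>UNIV. v $ i *s (of_nat N *s axis i 1)) = of_nat N *s (\<Sum>i\<in>UNIV. v $ i *s axis i 1)"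
      by (simp add: vec.scale_sum_right mult.commute)
    finally show ?thesis by (simp add: basis_expansion)
  qed
  moreover have "N > 0" using k(1) by (simp add: N_def prod_pos)
  ultimately show ?thesis by blast
qed

lemma span_of_subgroup:
  fixes L :: "(rat^'m::finite) set"
  assumes L: "add_subgroup L" and "v \<in> vec.span L"
  shows "\<exists>k>0. of_nat k *s v \<in> L"
  using assms(2)
proof (induction rule: vec.span_induct_alt)
  case base
  then show ?case using L by (auto simp: add_subgroup_def)
next
  case (step c x y)
  then obtain k where k: "k > 0" "of_nat k *s y \<in> L" by blast
  obtain a b where "quotient_of c = (a, b)" by fastforce
  then have ab: "b > 0" "c = of_int a / of_int b"
    by (simp_all add: quotient_of_denom_pos quotient_of_div)
  have "of_nat (k * nat b) *s (c *s x) = of_int (int k * a) *s x"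
    using ab by (simp add: vec_eq_iff)
  moreover have "of_nat (k * nat b) *s y = of_nat (nat b) *s (of_nat k *s y)"
    by (simp only: of_nat_mult vec.scale_scale mult.commute)
  ultimately have "of_nat (k * nat b) *s (c *s x + y) \<in> L"
    using add_subgroup_int_scale[OF L step(1), of "int k * a"] add_subgroup_nat_scale[OF L k(2), of "nat b"] L
    by (simp only: vec.scale_right_distrib add_subgroup_def)
  then show ?case using k ab by (intro exI[of _ "k * nat b"]) auto
qed

text \<open>
  A linear map that vanishes on a basis of the span but not on some further vector of an extended
  basis has a matrix with a nonzero row orthogonal to the span.
\<close>

lemma normal_vector_of_proper_span:
  fixes S :: "(rat^'m::finite) set"
  assumes "vec.span S \<noteq> UNIV"
  obtains w :: "rat^'m" where "w \<noteq> 0" "\<And>b. b \<in> S \<Longrightarrow> (\<Sum>j\<in>UNIV. b $ j * w $ j) = 0"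
proof -
  obtain B where B: "B \<subseteq> S" "vec.independent B" "S \<subseteq> vec.span B"
    by (rule vec.maximal_independent_subset[of S]) auto
  let ?B' = "vec.extend_basis B"
  have "\<not> ?B' \<subseteq> B"
  proof
    assume "?B' \<subseteq> B"
    then have "vec.span ?B' \<subseteq> vec.span S" using B(1) by (intro vec.span_mono) auto
    with vec.span_extend_basis[OF B(2)] assms show False by auto
  qed
  then obtain b0 where b0: "b0 \<in> ?B'" "b0 \<notin> B" by blast
  fix k :: 'm
  obtain g :: "rat^'m \<Rightarrow> rat^'m" where g: "Vector_Spaces.linear (*s) (*s) g"
    "\<forall>x\<in>?B'. g x = (if x \<in> B then 0 else axis k 1)"
    using vec.linear_independent_extend[OF vec.independent_extend_basis[OF B(2)],
        of "\<lambda>x. if x \<in> B then 0 else axis k 1"] by blast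
  have gS: "g b = 0" if "b \<in> S" for b
  proof (rule vec.linear_eq_0_on_span[OF g(1)])
    show "b \<in> vec.span B" using that B by blast
    show "g x = 0" if "x \<in> B" for x
      using g(2) that vec.extend_basis_superset[OF B(2)] by auto
  qed
  define w where "w = matrix g $ k"
  have gw: "g b $ k = (\<Sum>j\<in>UNIV. b $ j * w $ j)" for b
    using matrix_works[OF g(1), of b]
    by (simp add: matrix_vector_mult_def vec_eq_iff w_def mult.commute)
  have "g b0 $ k = 1" using g(2) b0 by (simp add: axis_def)
  then have "w \<noteq> 0" using gw[of b0] by auto
  moreover have "(\<Sum>j\<in>UNIV. b $ j * w $ j) = 0" if "b \<in> S" for b
    using gS[OF that] gw[of b] by simp
  ultimately show thesis by (rule that)
qed

lemma matrix_inv_mult: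
  fixes Q :: "'a::field^'m::finite^'m"
  assumes "invertible Q"
  shows "Q ** matrix_inv Q = mat 1" "matrix_inv Q ** Q = mat 1"
  using assms someI_ex[of "\<lambda>B. Q ** B = mat 1 \<and> B ** Q = mat 1"]
  unfolding invertible_def matrix_inv_def by blast+

lemma matrix_inv_apply:
  fixes Q :: "'a::field^'m::finite^'m"
  assumes "invertible Q"
  shows "Q *v (matrix_inv Q *v v) = v" "matrix_inv Q *v (Q *v v) = v"
  using matrix_inv_mult[OF assms] by (simp_all add: matrix_vector_mul_assoc)

lemma mem_image_mult_iff:
  fixes Q :: "'a::field^'m::finite^'m"
  assumes "invertible Q"
  shows "n \<in> (\<lambda>v. Q *v v) ` L \<longleftrightarrow> matrix_inv Q *v n \<in> L"
  by (auto simp: matrix_inv_apply[OF assms] intro!: image_eqI[of n _ "matrix_inv Q *v n"])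

lemma matrix_inv_unique:
  fixes A :: "'a::field^'m::finite^'m"
  assumes "A ** B = mat 1" shows "invertible A" "matrix_inv A = B"
proof -
  have BA: "B ** A = mat 1" using assms matrix_left_right_inverse by blast
  with assms show "invertible A" unfolding invertible_def by blast
  then have "matrix_inv A ** (A ** B) = B"
    by (simp add: matrix_mul_assoc matrix_inv_mult)
  then show "matrix_inv A = B" by (simp add: assms)
qed

lemma matrix_inv_matrix_inv:
  fixes Q :: "'a::field^'m::finite^'m"
  assumes "invertible Q"
  shows "invertible (matrix_inv Q)" "matrix_inv (matrix_inv Q) = Q"
  using matrix_inv_unique[OF matrix_inv_mult(2)[OF assms]] by auto

lemma matrix_inv_product:
  fixes Q Q' :: "'a::field^'m::finite^'m"
  assumes "invertible Q" "invertible Q'"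
  shows "invertible (Q ** Q')" "matrix_inv (Q ** Q') = matrix_inv Q' ** matrix_inv Q"
proof -
  have "Q ** Q' ** (matrix_inv Q' ** matrix_inv Q) = Q ** (Q' ** matrix_inv Q') ** matrix_inv Q"
    by (simp add: matrix_mul_assoc)
  then have "Q ** Q' ** (matrix_inv Q' ** matrix_inv Q) = mat 1"
    by (simp add: matrix_inv_mult assms)
  from matrix_inv_unique[OF this]
  show "invertible (Q ** Q')" "matrix_inv (Q ** Q') = matrix_inv Q' ** matrix_inv Q" by auto
qed

lemma mem_Lambda_of_iff:
  assumes "invertible Q"
  shows "n \<in> Lambda_of Q \<longleftrightarrow> n \<in> int_lattice \<and> matrix_inv Q *v n \<in> int_lattice"
  unfolding Lambda_of_def
  by (auto simp: matrix_inv_apply[OF assms] intro!: image_eqI[of n _ "matrix_inv Q *v n"])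

lemma GL_pairs_iff:
  "(Q, L) \<in> GL_pairs \<longleftrightarrow> invertible Q \<and> add_subgroup L \<and> L \<subseteq> int_lattice \<and>
    (\<forall>n\<in>L. matrix_inv Q *v n \<in> int_lattice) \<and> (\<exists>N>0. \<forall>v\<in>int_lattice. of_nat N *s v \<in> L)"
  unfolding GL_pairs_def
  by (auto simp: finite_index_iff mem_Lambda_of_iff subset_iff)

lemma Lambda_of_GL_pair:
  fixes Q :: "rat^'m::finite^'m"
  assumes Q: "invertible Q" shows "(Q, Lambda_of Q) \<in> GL_pairs"
proof -
  obtain d :: nat where d: "d > 0" "\<And>v. v \<in> int_lattice \<Longrightarrow> of_nat d *s (matrix_inv Q *v v) \<in> int_lattice"
    using matrix_denominator by blast
  have "\<forall>v\<in>int_lattice. of_nat d *s v \<in> Lambda_of Q"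
    using d by (auto simp: mem_Lambda_of_iff[OF Q] vec.scale int_lattice_closed)
  moreover have "add_subgroup (Lambda_of Q)"
    by (auto simp: add_subgroup_def mem_Lambda_of_iff[OF Q] int_lattice_closed
        matrix_vector_right_distrib vec.neg)
  ultimately show ?thesis
    using Q d by (auto simp: GL_pairs_iff mem_Lambda_of_iff)
qed

lemma pair_mult_GL_pairs:
  fixes Q Q' :: "rat^'m::finite^'m"
  assumes p: "(Q, L) \<in> GL_pairs" and p': "(Q', L') \<in> GL_pairs"
  shows "(Q ** Q', L \<inter> (\<lambda>v. Q *v v) ` L') \<in> GL_pairs"
proof -
  note p = p[unfolded GL_pairs_iff] and p' = p'[unfolded GL_pairs_iff]
  have Q: "invertible Q" and Q': "invertible Q'" using p p' by auto
  note mem = mem_image_mult_iff[OF Q]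
  obtain N where N: "N > 0" "\<And>v. v \<in> int_lattice \<Longrightarrow> of_nat N *s v \<in> L"
    using p by blast
  obtain N' where N': "N' > 0" "\<And>v. v \<in> int_lattice \<Longrightarrow> of_nat N' *s v \<in> L'"
    using p' by blast
  obtain d :: nat where d: "d > 0" "\<And>v. v \<in> int_lattice \<Longrightarrow> of_nat d *s (matrix_inv Q *v v) \<in> int_lattice"
    using matrix_denominator by blast
  have "of_nat (N * N' * d) *s v \<in> L \<inter> (\<lambda>v. Q *v v) ` L'" if v: "v \<in> int_lattice" for v
  proof -
    have "of_nat (N * N' * d) *s v = of_nat (N' * d) *s (of_nat N *s v)"
      by (simp only: of_nat_mult vec.scale_scale mult_ac)
    then have "of_nat (N * N' * d) *s v \<in> L"
      using add_subgroup_nat_scale[OF _ N(2)[OF v]] p by metis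
    moreover have "matrix_inv Q *v (of_nat (N * N' * d) *s v) =
        of_nat N *s (of_nat N' *s (of_nat d *s (matrix_inv Q *v v)))"
      by (simp only: of_nat_mult vec.scale_scale vec.scale mult_ac)
    then have "matrix_inv Q *v (of_nat (N * N' * d) *s v) \<in> L'"
      using add_subgroup_nat_scale[OF _ N'(2)[OF d(2)[OF v]]] p' by metis
    ultimately show ?thesis by (simp only: mem Int_iff simp_thms)
  qed
  then have "\<exists>N>0. \<forall>v\<in>int_lattice. of_nat N *s v \<in> L \<inter> (\<lambda>v. Q *v v) ` L'"
    using N N' d by (intro exI[of _ "N * N' * d"]) auto
  moreover have "add_subgroup (L \<inter> (\<lambda>v. Q *v v) ` L')"
    using p p' unfolding add_subgroup_def Int_iff mem
    by (auto simp: matrix_vector_right_distrib vec.neg matrix_inv_apply[OF Q])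
  moreover have "matrix_inv (Q ** Q') *v n \<in> int_lattice" if "n \<in> L \<inter> (\<lambda>v. Q *v v) ` L'" for n
    using that p' by (auto simp: mem matrix_inv_product[OF Q Q'] matrix_vector_mul_assoc[symmetric] matrix_inv_apply[OF Q])
  ultimately show ?thesis
    using matrix_inv_product[OF Q Q'] p unfolding GL_pairs_iff by blast
qed

lemma conjugate_GL_pair:
  fixes Q :: "rat^'m::finite^'m"
  assumes p: "(Q, L) \<in> GL_pairs"
  shows "(matrix_inv Q, (\<lambda>v. matrix_inv Q *v v) ` L) \<in> GL_pairs"
proof -
  note p = p[unfolded GL_pairs_iff]
  have Q: "invertible Q" using p by auto
  note mem = mem_image_mult_iff[OF matrix_inv_matrix_inv(1)[OF Q], unfolded matrix_inv_matrix_inv(2)[OF Q]]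
  obtain N where N: "N > 0" "\<And>v. v \<in> int_lattice \<Longrightarrow> of_nat N *s v \<in> L" using p by blast
  obtain d :: nat where d: "d > 0" "\<And>v. v \<in> int_lattice \<Longrightarrow> of_nat d *s (Q *v v) \<in> int_lattice"
    using matrix_denominator by blast
  have "of_nat (N * d) *s v \<in> (\<lambda>v. matrix_inv Q *v v) ` L" if "v \<in> int_lattice" for v
    using N(2)[OF d(2)[OF that]] by (simp add: mem vec.scale mult.commute)
  then have "\<exists>N>0. \<forall>v\<in>int_lattice. of_nat N *s v \<in> (\<lambda>v. matrix_inv Q *v v) ` L"
    using N d by (intro exI[of _ "N * d"]) auto
  moreover have "add_subgroup ((\<lambda>v. matrix_inv Q *v v) ` L)"
    using p unfolding add_subgroup_def mem
    by (auto simp: matrix_vector_right_distrib vec.neg matrix_inv_apply[OF Q])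
  moreover have "(\<lambda>v. matrix_inv Q *v v) ` L \<subseteq> int_lattice" using p by auto
  moreover have "\<forall>n\<in>(\<lambda>v. matrix_inv Q *v v) ` L. Q *v n \<in> int_lattice"
    using p by (auto simp: matrix_inv_apply[OF Q])
  ultimately show ?thesis
    unfolding GL_pairs_iff matrix_inv_matrix_inv(2)[OF Q] using matrix_inv_matrix_inv(1)[OF Q] by blast
qed


section \<open>The correspondence of a pair\<close>

lemma pairing_axis_right: "pairing u (axis i c) = of_rat (u $ i) * c"
proof -
  have "pairing u (axis i c) = (\<Sum>j\<in>UNIV. if j = i then of_rat (u $ j) * c else 0)"
    unfolding pairing_def by (rule sum.cong) (auto simp: axis_def)
  then show ?thesis by simp
qed

lemma half_not_Int: "(1/2 :: real) \<notin> \<int>"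
proof
  assume "(1/2 :: real) \<in> \<int>"
  then obtain k :: int where "(1/2 :: real) = of_int k" by (rule Ints_cases)
  then have "(1 :: real) = of_int (2 * k)" by simp
  then have "1 = 2 * k" by (simp only: of_int_eq_1_iff)
  then show False by presburger
qed

lemma pairing_Ints_imp_zero:
  assumes "\<And>t. pairing w t \<in> \<int>" shows "w = 0"
proof (rule ccontr)
  assume "w \<noteq> 0"
  then obtain i where i: "w $ i \<noteq> 0" by (auto simp: vec_eq_iff)
  then have "pairing w (axis i (1 / (2 * of_rat (w $ i)))) = 1/2"
    by (simp add: pairing_axis_right)
  with assms half_not_Int show False by metis
qed

text \<open>
  Duality for \<open>\<int>\<^sup>m / L\<close>.  With \<open>N \<int>\<^sup>m \<subseteq> L\<close> the vectors \<open>v / N\<close>, \<open>v \<in> L\<close>, form a finite,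
  hence closed, subgroup of the torus that omits the class of \<open>n / N\<close>.  A separating character
  \<open>a\<close> yields the required vector \<open>a / N\<close>, since pairing \<open>a\<close> with \<open>v / N\<close> is pairing
  \<open>v\<close> with \<open>a / N\<close>.  The subgroup is placed in the first factor of the product of two tori.
\<close>

lemma sublattice_separation:
  fixes L :: "(rat^'m::finite) set"
  assumes L: "L \<in> finite_index_subgroups" and n: "n \<in> int_lattice" "n \<notin> L"
  obtains s where "\<And>v. v \<in> L \<Longrightarrow> pairing v s \<in> \<int>" "pairing n s \<notin> \<int>"
proof -
  obtain N where N: "N > 0" "\<And>v. v \<in> int_lattice \<Longrightarrow> of_nat N *s v \<in> L"
    and sub: "add_subgroup L" "L \<subseteq> int_lattice"
    using L unfolding finite_index_iff by blast
  define scale :: "rat^'m \<Rightarrow> real^'m" where "scale v = (\<chi> i. of_rat (v $ i) / of_nat N)" for v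
  have scale_add: "scale (u + v) = scale u + scale v" for u v
    by (simp add: scale_def vec_eq_iff of_rat_add add_divide_distrib)
  have scale_minus: "scale (- v) = - scale v" for v
    by (simp add: scale_def vec_eq_iff of_rat_minus)
  have scale_zero: "scale 0 = 0"
    by (simp add: scale_def vec_eq_iff)
  have symmetric: "pairing u (scale v) = pairing v (scale u)" for u v
    by (simp add: pairing_def scale_def mult.commute)
  define H :: "('m torus \<times> 'm torus) set" where "H = (\<lambda>v. (torus_of (scale v), 0)) ` L"
  have "finite H"
  proof (rule finite_subset)
    show "H \<subseteq> {torus_of s | s. \<forall>i. of_nat N * s $ i \<in> \<int>} \<times> {0}"
    proof
      fix h assume "h \<in> H"
      then obtain v where v: "v \<in> L" "h = (torus_of (scale v), 0)" by (auto simp: H_def)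
      have "real N * scale v $ i \<in> \<int>" for i
      proof -
        have "v $ i \<in> \<int>" using v sub by (auto simp: int_lattice_iff)
        then obtain z where "v $ i = of_int z" by (rule Ints_cases)
        then show ?thesis using N by (simp add: scale_def)
      qed
      with v show "h \<in> {torus_of s | s. \<forall>i. of_nat N * s $ i \<in> \<int>} \<times> {0}" by blast
    qed
    show "finite ({torus_of s :: 'm torus | s. \<forall>i. of_nat N * s $ i \<in> \<int>} \<times> {0 :: 'm torus})"
      by (intro finite_cartesian_product finite_torsion_points[OF N(1)]) simp
  qed
  then have "closed H" by (rule finite_imp_closed)
  moreover have "add_subgroup H"
    unfolding add_subgroup_def
  proof (intro conjI ballI)
    show "0 \<in> H"
      unfolding H_def using sub(1)
      by (intro image_eqI[of _ _ 0]) (auto simp: scale_zero torus_of_zero zero_prod_def add_subgroup_def)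
    fix x y assume "x \<in> H" "y \<in> H"
    then obtain u v where "u \<in> L" "v \<in> L" "x = (torus_of (scale u), 0)" "y = (torus_of (scale v), 0)"
      by (auto simp: H_def)
    then show "x + y \<in> H"
      unfolding H_def using sub(1)
      by (intro image_eqI[of _ _ "u + v"]) (auto simp: scale_add torus_of_add add_subgroup_def)
  next
    fix x assume "x \<in> H"
    then obtain u where "u \<in> L" "x = (torus_of (scale u), 0)"
      by (auto simp: H_def)
    then show "- x \<in> H"
      unfolding H_def using sub(1)
      by (intro image_eqI[of _ _ "- u"]) (auto simp: scale_minus torus_of_minus add_subgroup_def)
  qed
  moreover have "(torus_of (scale n), 0) \<notin> H"
  proof
    assume "(torus_of (scale n), 0) \<in> H"
    then obtain v where v: "v \<in> L" "torus_of (scale n) = torus_of (scale v)" by (auto simp: H_def)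
    define q :: "rat^'m" where "q = (\<chi> i. (n $ i - v $ i) / of_nat N)"
    have "q $ i \<in> \<int>" for i
    proof -
      have "(of_rat (q $ i) :: real) = scale n $ i - scale v $ i"
        by (simp add: q_def scale_def of_rat_divide of_rat_diff diff_divide_distrib)
      also have "\<dots> \<in> \<int>" using v(2) by (simp add: torus_of_eq_iff)
      finally obtain z where "(of_rat (q $ i) :: real) = of_int z" by (rule Ints_cases)
      then have "(of_rat (q $ i) :: real) = of_rat (of_int z)" by simp
      then have "q $ i = of_int z" by (simp only: of_rat_eq_iff)
      then show ?thesis by simp
    qed
    then have "of_nat N *s q \<in> L" by (intro N(2)) (simp add: int_lattice_iff)
    moreover have "n = v + of_nat N *s q" using N(1) by (simp add: q_def vec_eq_iff)
    ultimately have "n \<in> L" using v(1) sub(1) by (auto simp: add_subgroup_def)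
    with n show False by simp
  qed
  ultimately obtain a b where ab: "\<forall>h\<in>H. pair_char a b h = 1"
    "pair_char a b (torus_of (scale n), 0) \<noteq> 1"
    by (rule closed_subgroup_separation)
  have char: "pair_char a b (torus_of (scale v), 0) = 1 \<longleftrightarrow> pairing v (scale (rat_vec a)) \<in> \<int>" for v
    unfolding torus_of_zero[symmetric] pair_char_def prod.case torus_char_pair_eq_1_iff
    by (simp add: symmetric[of v])
  show thesis
  proof
    show "pairing n (scale (rat_vec a)) \<notin> \<int>" using ab(2) char by blast
    show "pairing v (scale (rat_vec a)) \<in> \<int>" if "v \<in> L" for v
      using ab(1) that unfolding char[symmetric] H_def by blast
  qed
qed

lemma GL_pairsD:
  assumes "(Q, L) \<in> GL_pairs"
  shows "invertible Q" "add_subgroup L" "L \<subseteq> int_lattice" "L \<in> finite_index_subgroups"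
    "\<And>n. n \<in> L \<Longrightarrow> matrix_inv Q *v n \<in> int_lattice"
    "theta_perp (Q, L) \<subseteq> int_lattice \<times> int_lattice"
proof -
  show "invertible Q" "add_subgroup L" "L \<subseteq> int_lattice" "L \<in> finite_index_subgroups"
    "\<And>n. n \<in> L \<Longrightarrow> matrix_inv Q *v n \<in> int_lattice"
    using assms unfolding GL_pairs_iff finite_index_iff by auto
  then show "theta_perp (Q, L) \<subseteq> int_lattice \<times> int_lattice"
    by (auto simp: theta_perp_def int_lattice_closed)
qed

lemma mem_theta_perp_iff:
  "(u, v) \<in> theta_perp (Q, L) \<longleftrightarrow> - v \<in> L \<and> u = matrix_inv Q *v (- v)"
  by (auto simp: theta_perp_def)

text \<open>
  On the curve \<open>t \<mapsto> (Q\<^sup>T t, t)\<close> the character \<open>(u, v)\<close> is the exponential of a linear form in \<open>t\<close>;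
  a linear form with integral values is zero.
\<close>

lemma annihilator_along_curve:
  assumes "\<And>t. (torus_of (adjoint_action Q t), torus_of t) \<in> P" "(u, v) \<in> annihilator P"
  shows "v = - (Q *v u)"
proof -
  have "pairing (Q *v u + v) t \<in> \<int>" for t
    using assms unfolding annihilator_iff by (simp add: pairing_add_left pairing_mult)
  then have "Q *v u + v = 0" by (rule pairing_Ints_imp_zero)
  then show ?thesis by (simp add: add_eq_0_iff)
qed

lemma mem_polar_theta_perp_iff:
  assumes "(Q, L) \<in> GL_pairs"
  shows "(torus_of s, torus_of t) \<in> polar (theta_perp (Q, L)) \<longleftrightarrow>
    (\<forall>n\<in>L. pairing (matrix_inv Q *v n) s - pairing n t \<in> \<int>)"
proof -
  have "(\<forall>(u, v)\<in>theta_perp (Q, L). pairing u s + pairing v t \<in> \<int>) \<longleftrightarrow>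
      (\<forall>n\<in>L. pairing (matrix_inv Q *v n) s + pairing (- n) t \<in> \<int>)"
    unfolding theta_perp_def by blast
  then show ?thesis
    unfolding polar_iff[OF GL_pairsD(6)[OF assms]] by (simp add: pairing_minus_left)
qed

lemma curve_in_polar:
  assumes p: "(Q, L) \<in> GL_pairs"
  shows "(torus_of (adjoint_action Q t), torus_of t) \<in> polar (theta_perp (Q, L))"
  unfolding mem_polar_theta_perp_iff[OF p]
  by (simp add: pairing_mult[symmetric] matrix_inv_apply[OF GL_pairsD(1)[OF p]])

text \<open>
  The curve determines \<open>u\<close> from \<open>v\<close>, and the points \<open>(0, y)\<close> with \<open>y\<close> killed by \<open>L\<close> force
  \<open>- v \<in> L\<close>.
\<close>

lemma annihilator_polar_theta_perp:
  assumes p: "(Q, L) \<in> GL_pairs"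
  shows "annihilator (polar (theta_perp (Q, L))) = theta_perp (Q, L)"
proof (intro set_eqI, clarify)
  fix u v
  note D = GL_pairsD[OF p]
  show "(u, v) \<in> annihilator (polar (theta_perp (Q, L))) \<longleftrightarrow> (u, v) \<in> theta_perp (Q, L)"
  proof
    assume uv: "(u, v) \<in> annihilator (polar (theta_perp (Q, L)))"
    then have "v = - (Q *v u)" by (rule annihilator_along_curve[OF curve_in_polar[OF p]])
    then have u: "u = matrix_inv Q *v (- v)" by (simp add: matrix_inv_apply[OF D(1)])
    have v: "- v \<in> int_lattice" using uv by (simp add: annihilator_iff int_lattice_closed)
    have "- v \<in> L"
    proof (rule ccontr)
      assume "- v \<notin> L"
      then obtain s where s: "\<And>w. w \<in> L \<Longrightarrow> pairing w s \<in> \<int>" "pairing (- v) s \<notin> \<int>"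
        using sublattice_separation[OF D(4) v] by blast
      have "(torus_of 0, torus_of s) \<in> polar (theta_perp (Q, L))"
        unfolding mem_polar_theta_perp_iff[OF p] using s(1) by simp
      then have "pairing u 0 + pairing v s \<in> \<int>" using uv unfolding annihilator_iff by blast
      with s(2) show False by (simp add: pairing_minus_left)
    qed
    with u show "(u, v) \<in> theta_perp (Q, L)" by (simp add: mem_theta_perp_iff)
  next
    assume uv: "(u, v) \<in> theta_perp (Q, L)"
    then have "u \<in> int_lattice" "v \<in> int_lattice" using D(6) by auto
    with uv show "(u, v) \<in> annihilator (polar (theta_perp (Q, L)))"
      unfolding annihilator_iff polar_iff[OF D(6)] by blast
  qed
qed

lemma theta_eqI:
  assumes "closed P" "add_subgroup P" "annihilator P = theta_perp p"
  shows "theta p = P"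
  unfolding theta_def
  by (rule the_equality) (use assms annihilator_inject in blast)+

lemma theta_eq_polar:
  assumes "(Q, L) \<in> GL_pairs" shows "theta (Q, L) = polar (theta_perp (Q, L))"
  using GL_pairsD(6)[OF assms]
  by (intro theta_eqI closed_polar add_subgroup_polar annihilator_polar_theta_perp assms)

lemma theta_properties:
  assumes "(Q, L) \<in> GL_pairs"
  shows "closed (theta (Q, L))" "add_subgroup (theta (Q, L))"
    "annihilator (theta (Q, L)) = theta_perp (Q, L)"
    "(torus_of s, torus_of t) \<in> theta (Q, L) \<longleftrightarrow>
      (\<forall>n\<in>L. pairing (matrix_inv Q *v n) s - pairing n t \<in> \<int>)"
    "(torus_of (adjoint_action Q t), torus_of t) \<in> theta (Q, L)"
  unfolding theta_eq_polar[OF assms]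
  by (intro closed_polar add_subgroup_polar GL_pairsD(6) annihilator_polar_theta_perp
      mem_polar_theta_perp_iff curve_in_polar assms)+

text \<open>
  The annihilator exhibits \<open>L\<close> and the action of \<open>Q\<inverse>\<close> on it; since \<open>L\<close> has finite index, that
  determines \<open>Q\<inverse>\<close>.
\<close>

lemma theta_inject:
  assumes p: "(Q, L) \<in> GL_pairs" and p': "(Q', L') \<in> GL_pairs"
    and eq: "theta (Q, L) = theta (Q', L')"
  shows "(Q, L) = (Q', L')"
proof -
  have "theta_perp (Q, L) = theta_perp (Q', L')"
    using theta_properties(3)[OF p] theta_properties(3)[OF p'] eq by simp
  then have perp: "n \<in> L \<and> u = matrix_inv Q *v n \<longleftrightarrow> n \<in> L' \<and> u = matrix_inv Q' *v n" for u n
    using mem_theta_perp_iff[of u "- n" Q L] mem_theta_perp_iff[of u "- n" Q' L'] by simp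
  then have L: "L = L'" by blast
  obtain N where N: "N > 0" "\<And>v. v \<in> int_lattice \<Longrightarrow> of_nat N *s v \<in> L"
    using p unfolding GL_pairs_iff by blast
  have "matrix_inv Q *v v = matrix_inv Q' *v v" for v
  proof -
    obtain d :: nat where d: "d > 0" "of_nat d *s v \<in> int_lattice" by (rule vector_denominator)
    have "matrix_inv Q *v (of_nat N *s (of_nat d *s v)) = matrix_inv Q' *v (of_nat N *s (of_nat d *s v))"
      using perp N(2)[OF d(2)] by blast
    then show ?thesis using N(1) d(1) by (simp add: vec.scale)
  qed
  then have "matrix_inv Q = matrix_inv Q'" by (simp add: matrix_eq)
  then have "Q = Q'"
    using matrix_inv_matrix_inv(2) GL_pairsD(1)[OF p] GL_pairsD(1)[OF p'] by metis
  with L show ?thesis by simp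
qed

text \<open>
  Swapping the two factors turns \<open>(Q\<inverse> n, - n)\<close> into \<open>(- n, Q\<inverse> n) = (Q n', - n')\<close> with
  \<open>n' = - Q\<inverse> n\<close>.
\<close>

lemma theta_converse:
  assumes p: "(Q, L) \<in> GL_pairs"
  shows "(theta (Q, L))\<inverse> = theta (matrix_inv Q, (\<lambda>v. matrix_inv Q *v v) ` L)"
proof -
  let ?P = "theta (Q, L)" and ?p' = "(matrix_inv Q, (\<lambda>v. matrix_inv Q *v v) ` L)"
  note Q = GL_pairsD(1)[OF p] and P = theta_properties[OF p]
  have conv: "?P\<inverse> = prod.swap -` ?P" by auto
  have "closed (?P\<inverse>)"
  proof -
    have "continuous_on UNIV (prod.swap :: 'a torus \<times> 'a torus \<Rightarrow> _)"
      unfolding prod.swap_def by (intro continuous_intros)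
    then show ?thesis
      unfolding conv by (rule closed_vimage[OF P(1)])
  qed
  moreover have "add_subgroup (?P\<inverse>)"
    using P(2) by (auto simp: add_subgroup_def zero_prod_def) force+
  moreover have "annihilator (?P\<inverse>) = theta_perp ?p'"
  proof (intro set_eqI, clarify)
    fix u v
    have "(u, v) \<in> annihilator (?P\<inverse>) \<longleftrightarrow> (v, u) \<in> annihilator ?P"
      unfolding annihilator_iff by (auto simp: add.commute)
    also have "\<dots> \<longleftrightarrow> - u \<in> L \<and> v = matrix_inv Q *v (- u)"
      unfolding P(3) mem_theta_perp_iff ..
    also have "\<dots> \<longleftrightarrow> (u, v) \<in> theta_perp ?p'"
    proof -
      note mem = mem_image_mult_iff[OF matrix_inv_matrix_inv(1)[OF Q], unfolded matrix_inv_matrix_inv(2)[OF Q]]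
      have neg: "- u \<in> L \<longleftrightarrow> u \<in> L"
        using GL_pairsD(2)[OF p] unfolding add_subgroup_def by (metis minus_minus)
      have "v = matrix_inv Q *v (- u) \<longleftrightarrow> u = Q *v (- v)"
        by (metis matrix_inv_apply[OF Q] vec.neg minus_minus)
      then show ?thesis
        unfolding mem_theta_perp_iff matrix_inv_matrix_inv(2)[OF Q] mem by (auto simp: neg)
    qed
    finally show "(u, v) \<in> annihilator (?P\<inverse>) \<longleftrightarrow> (u, v) \<in> theta_perp ?p'" .
  qed
  ultimately show ?thesis by (rule theta_eqI[symmetric])
qed

section \<open>Finite-to-one correspondences\<close>

lemma finite_theta_fibre:
  assumes p: "(Q, L) \<in> GL_pairs" shows "finite {y. (0, y) \<in> theta (Q, L)}"
proof -
  obtain N where N: "N > 0" "\<And>v. v \<in> int_lattice \<Longrightarrow> of_nat N *s v \<in> L"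
    using p unfolding GL_pairs_iff by blast
  have "{y. (0, y) \<in> theta (Q, L)} \<subseteq> {torus_of t | t. \<forall>i. of_nat N * t $ i \<in> \<int>}"
  proof
    fix y assume "y \<in> {y. (0, y) \<in> theta (Q, L)}"
    moreover obtain t where y: "y = torus_of t" by (rule torus_cases)
    ultimately have mem: "(torus_of 0, torus_of t) \<in> theta (Q, L)" by (simp add: torus_of_zero)
    have "of_nat N * t $ i \<in> \<int>" for i
    proof -
      have "of_nat N *s axis i 1 \<in> L" by (intro N int_lattice_closed)
      with mem have "pairing (matrix_inv Q *v (of_nat N *s axis i 1)) 0 - pairing (of_nat N *s axis i 1) t \<in> \<int>"
        unfolding theta_properties(4)[OF p] by blast
      then show ?thesis by (simp add: pairing_scale_left pairing_axis)
    qed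
    with y show "y \<in> {torus_of t | t. \<forall>i. of_nat N * t $ i \<in> \<int>}" by blast
  qed
  then show ?thesis using finite_torsion_points[OF N(1)] by (rule finite_subset)
qed

lemma snd_theta:
  assumes p: "(Q, L) \<in> GL_pairs" shows "snd ` theta (Q, L) = UNIV"
proof -
  have "y \<in> snd ` theta (Q, L)" for y
  proof -
    obtain t where "y = torus_of t" by (rule torus_cases)
    then show ?thesis using theta_properties(5)[OF p, of t] by force
  qed
  then show ?thesis by blast
qed

text \<open>
  The assertions about the first coordinate are those about the second one for the conjugate.
\<close>

lemma theta_in_Pf:
  assumes p: "(Q, L) \<in> GL_pairs" shows "theta (Q, L) \<in> Pf"
proof -
  note p' = conjugate_GL_pair[OF p]
  have "fst ` theta (Q, L) = snd ` ((theta (Q, L))\<inverse>)" by force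
  then have "fst ` theta (Q, L) = UNIV"
    unfolding theta_converse[OF p] snd_theta[OF p'] .
  moreover have "{x. (x, 0) \<in> theta (Q, L)} = {x. (0, x) \<in> (theta (Q, L))\<inverse>}" by auto
  then have "finite {x. (x, 0) \<in> theta (Q, L)}"
    unfolding theta_converse[OF p] using finite_theta_fibre[OF p'] by simp
  ultimately show ?thesis
    using theta_properties(1,2)[OF p] snd_theta[OF p] finite_theta_fibre[OF p]
    by (simp add: Pf_def correspondence_def finite_to_one_def)
qed

lemma add_subgroup_annihilator:
  "add_subgroup (annihilator P)"
  unfolding add_subgroup_def
proof (intro conjI ballI; clarify?)
  show "0 \<in> annihilator P"
    unfolding zero_prod_def annihilator_iff by (simp add: int_lattice_closed)
  fix u v assume uv: "(u, v) \<in> annihilator P"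
  show "- (u, v) \<in> annihilator P"
    using uv unfolding uminus_Pair annihilator_iff
    by (auto simp: int_lattice_closed pairing_minus_left)
      (metis Ints_minus minus_add_distrib add_uminus_conv_diff)
  fix u' v' assume uv': "(u', v') \<in> annihilator P"
  show "(u, v) + (u', v') \<in> annihilator P"
    unfolding add_Pair annihilator_iff
  proof (intro conjI allI impI)
    fix s t assume "(torus_of s, torus_of t) \<in> P"
    with uv uv' have "(pairing u s + pairing v t) + (pairing u' s + pairing v' t) \<in> \<int>"
      unfolding annihilator_iff by (intro Ints_add[of "_ + _" "_ + _"]) blast+
    then show "pairing (u + u') s + pairing (v + v') t \<in> \<int>"
      by (simp add: pairing_add_left algebra_simps)
  qed (use uv uv' in \<open>auto simp: annihilator_iff int_lattice_closed\<close>)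
qed

text \<open>
  A character of one factor that is trivial on a correspondence is trivial on the whole torus.
\<close>

lemma annihilator_of_surjection:
  assumes "correspondence P"
  shows "(u, 0) \<in> annihilator P \<Longrightarrow> u = 0" "(0, v) \<in> annihilator P \<Longrightarrow> v = 0"
proof -
  assume u: "(u, 0) \<in> annihilator P"
  show "u = 0"
  proof (rule pairing_Ints_imp_zero)
    fix s
    have "torus_of s \<in> fst ` P" using assms by (simp add: correspondence_def)
    then obtain y where "(torus_of s, y) \<in> P" by force
    moreover obtain t where "y = torus_of t" by (rule torus_cases)
    ultimately show "pairing u s \<in> \<int>" using u unfolding annihilator_iff by fastforce
  qed
next
  assume v: "(0, v) \<in> annihilator P"
  show "v = 0"
  proof (rule pairing_Ints_imp_zero)
    fix t
    have "torus_of t \<in> snd ` P" using assms by (simp add: correspondence_def)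
    then obtain x where "(x, torus_of t) \<in> P" by force
    moreover obtain s where "x = torus_of s" by (rule torus_cases)
    ultimately show "pairing v t \<in> \<int>" using v unfolding annihilator_iff by fastforce
  qed
qed

text \<open>
  Along the line one coordinate runs through the open unit interval, whose points are distinct modulo
  the integers.
\<close>

lemma infinite_torus_line:
  fixes w :: "real^'m::finite" assumes "w \<noteq> 0"
  shows "infinite (range (\<lambda>c. torus_of (c *\<^sub>R w)))"
proof -
  obtain i where i: "w $ i \<noteq> 0" using assms by (auto simp: vec_eq_iff)
  have "inj_on (\<lambda>r. torus_of ((r / w $ i) *\<^sub>R w)) {0<..<1}"
  proof (rule inj_onI)
    fix r r' :: real
    assume r: "r \<in> {0<..<1}" "r' \<in> {0<..<1}"
      and eq: "torus_of ((r / w $ i) *\<^sub>R w) = torus_of ((r' / w $ i) *\<^sub>R w)"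
    have "((r / w $ i) *\<^sub>R w) $ i - ((r' / w $ i) *\<^sub>R w) $ i \<in> \<int>"
      using eq unfolding torus_of_eq_iff by (rule spec)
    then have "r - r' \<in> \<int>" using i by simp
    moreover have "\<bar>r - r'\<bar> < 1" using r by auto
    ultimately show "r = r'" using Ints_nonzero_abs_less1 by fastforce
  qed
  then have "infinite ((\<lambda>r. torus_of ((r / w $ i) *\<^sub>R w)) ` {0<..<1 :: real})"
    by (simp add: finite_image_iff)
  moreover have "(\<lambda>r. torus_of ((r / w $ i) *\<^sub>R w)) ` {0<..<1} \<subseteq> range (\<lambda>c. torus_of (c *\<^sub>R w))"
    by blast
  ultimately show ?thesis using finite_subset by blast
qed

text \<open>
  The finite-to-one condition enters here.  A nonzero vector \<open>w\<close> orthogonal to the projected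
  annihilator would make the annihilator kill all points \<open>(0, c w)\<close>; by duality they would lie
  in \<open>P\<close>, and there are infinitely many of them.
\<close>

lemma span_of_annihilator_projection:
  fixes P :: "('m::finite torus \<times> 'm torus) set"
  assumes P: "closed P" "add_subgroup P" and fin: "finite {y. (0, y) \<in> P}"
  shows "vec.span {n. \<exists>u. (u, - n) \<in> annihilator P} = UNIV"
proof (rule ccontr)
  assume "vec.span {n. \<exists>u. (u, - n) \<in> annihilator P} \<noteq> UNIV"
  then obtain w :: "rat^'m" where w: "w \<noteq> 0"
    "\<And>b. b \<in> {n. \<exists>u. (u, - n) \<in> annihilator P} \<Longrightarrow> (\<Sum>j\<in>UNIV. b $ j * w $ j) = 0"
    using normal_vector_of_proper_span by blast
  define w' :: "real^'m" where "w' = (\<chi> j. of_rat (w $ j))"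
  have "w' \<noteq> 0" using w(1) by (auto simp: w'_def vec_eq_iff)
  have "(torus_of 0, torus_of (c *\<^sub>R w')) \<in> P" for c
  proof (rule mem_closed_subgroupI[OF P])
    fix u v assume "(u, v) \<in> annihilator P"
    then have "(\<Sum>j\<in>UNIV. (- v) $ j * w $ j) = 0" by (intro w(2)) auto
    then have "(\<Sum>j\<in>UNIV. v $ j * w $ j) = 0" by (simp add: sum_negf)
    then have "pairing v w' = 0"
      unfolding pairing_def w'_def
      by (simp flip: of_rat_mult of_rat_sum)
    then show "pairing u 0 + pairing v (c *\<^sub>R w') \<in> \<int>" by (simp add: pairing_scale_right)
  qed
  then have "range (\<lambda>c. torus_of (c *\<^sub>R w')) \<subseteq> {y. (0, y) \<in> P}"
    by (auto simp: torus_of_zero)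
  with fin infinite_torus_line[OF \<open>w' \<noteq> 0\<close>] show False using finite_subset by blast
qed

text \<open>
  A partial homomorphism with spanning domain is the restriction of a linear map: its values on a
  basis contained in the domain extend to a linear map \<open>g\<close>, clearing denominators puts a positive
  multiple of each \<open>(g v, v)\<close> into \<open>A\<close>, and \<open>g\<close> agrees with \<open>A\<close> because \<open>A\<close> is single-valued.
\<close>

lemma subgroup_graph_in_linear_graph:
  fixes A :: "((rat^'m::finite) \<times> (rat^'m)) set"
  assumes A: "add_subgroup A" and single: "\<And>u. (u, 0) \<in> A \<Longrightarrow> u = 0"
    and span: "vec.span {v. \<exists>u. (u, v) \<in> A} = UNIV"
  obtains M :: "rat^'m^'m" where "\<And>u v. (u, v) \<in> A \<Longrightarrow> u = M *v v"
proof -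
  have A_add: "(u + u', v + v') \<in> A" if "(u, v) \<in> A" "(u', v') \<in> A" for u v u' v'
    using A that unfolding add_subgroup_def by (metis add_Pair)
  have A_scale: "(of_int k *s u, of_int k *s v) \<in> A" if "(u, v) \<in> A" for k u v
    by (rule add_subgroup_int_multiple[OF A, where f = "\<lambda>k. (of_int k *s u, of_int k *s v)"])
      (use that in \<open>simp_all add: vec.scale_left_distrib\<close>)
  let ?D = "{v. \<exists>u. (u, v) \<in> A}"
  obtain B where B: "B \<subseteq> ?D" "vec.independent B" "?D \<subseteq> vec.span B"
    by (rule vec.maximal_independent_subset[of ?D]) auto
  have span_B: "v \<in> vec.span B" for v
    using span vec.span_minimal[OF B(3) vec.subspace_span] by auto
  obtain g where g: "Vector_Spaces.linear (*s) (*s) g" "\<forall>b\<in>B. g b = (SOME u. (u, b) \<in> A)"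
    using vec.linear_independent_extend[OF B(2), of "\<lambda>b. SOME u. (u, b) \<in> A"] by blast
  have g_B: "(g b, b) \<in> A" if "b \<in> B" for b
  proof -
    have "\<exists>u. (u, b) \<in> A" using B(1) that by blast
    from someI_ex[OF this] show ?thesis using g(2) that by simp
  qed
  have g_add: "g (x + y) = g x + g y" and g_scale: "g (c *s x) = c *s g x" for x y c
    using g(1) unfolding Vector_Spaces.linear_iff by blast+
  have multiple: "\<exists>k>0. (of_int k *s g v, of_int k *s v) \<in> A" for v
    using span_B[of v]
  proof (induction rule: vec.span_induct_alt)
    case base
    have "g 0 = 0" using g_scale[of 0 0] by simp
    then have "(of_int 1 *s g 0, of_int 1 *s 0) \<in> A"
      using A by (simp add: add_subgroup_def zero_prod_def)
    then show ?case by (intro exI[of _ 1]) simp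
  next
    case (step c x y)
    then obtain k where k: "k > 0" "(of_int k *s g y, of_int k *s y) \<in> A" by blast
    obtain a b where "quotient_of c = (a, b)" by fastforce
    then have ab: "b > 0" "c = of_int a / of_int b"
      by (simp_all add: quotient_of_denom_pos quotient_of_div)
    have "(of_int (k * a) *s g x + of_int b *s (of_int k *s g y),
        of_int (k * a) *s x + of_int b *s (of_int k *s y)) \<in> A"
      by (intro A_add A_scale g_B step(1) k(2))
    also have "of_int (k * a) *s g x + of_int b *s (of_int k *s g y) =
        of_int (k * b) *s g (c *s x + y)"
      using ab by (simp add: vec_eq_iff g_add g_scale field_simps)
    also have "of_int (k * a) *s x + of_int b *s (of_int k *s y) = of_int (k * b) *s (c *s x + y)"
      using ab by (simp add: vec_eq_iff field_simps)
    finally show ?case using k(1) ab(1) by (intro exI[of _ "k * b"]) simp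
  qed
  show thesis
  proof
    fix u v assume uv: "(u, v) \<in> A"
    obtain k where k: "k > 0" "(of_int k *s g v, of_int k *s v) \<in> A" using multiple by blast
    have "(of_int k *s u + of_int (- 1) *s (of_int k *s g v),
        of_int k *s v + of_int (- 1) *s (of_int k *s v)) \<in> A"
      by (intro A_add A_scale uv k(2))
    also have "of_int k *s v + of_int (- 1) *s (of_int k *s v) = 0"
      by (simp add: vec_eq_iff)
    finally have "of_int k *s u + of_int (- 1) *s (of_int k *s g v) = 0" by (rule single)
    then have "u = g v" using k(1) by (simp add: vec_eq_iff)
    then show "u = matrix g *v v" by (simp only: matrix_works[OF g(1)])
  qed
qed

text \<open>
  The annihilator, with the sign of its second entry reversed, is a subgroup that lies in the graph of
  a rational matrix \<open>M\<close>.  The matrix is injective because the annihilator contains no \<open>(0, v)\<close> with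
  \<open>v \<noteq> 0\<close>, and \<open>Q\<close> is its inverse.
\<close>

lemma Pf_imp_theta:
  fixes P :: "('m::finite torus \<times> 'm torus) set"
  assumes "P \<in> Pf"
  obtains Q L where "(Q, L) \<in> GL_pairs" "P = theta (Q, L)"
proof -
  have corr: "correspondence P" and P: "closed P" "add_subgroup P" and fin: "finite {y. (0, y) \<in> P}"
    using assms by (auto simp: Pf_def correspondence_def finite_to_one_def)
  define A where "A = {(u, n). (u, - n) \<in> annihilator P}"
  have A: "add_subgroup A"
    unfolding add_subgroup_def
  proof (intro conjI ballI)
    note ann = add_subgroup_annihilator[of P, unfolded add_subgroup_def]
    show "0 \<in> A" using ann by (simp add: A_def zero_prod_def)
    fix x y assume "x \<in> A" "y \<in> A"
    then have "(fst x, - snd x) \<in> annihilator P" "(fst y, - snd y) \<in> annihilator P"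
      by (auto simp: A_def)
    then have "(fst x, - snd x) + (fst y, - snd y) \<in> annihilator P"
      using ann by blast
    then show "x + y \<in> A" by (simp add: A_def plus_prod_def)
  next
    note ann = add_subgroup_annihilator[of P, unfolded add_subgroup_def]
    fix x assume "x \<in> A"
    then have "(fst x, - snd x) \<in> annihilator P" by (auto simp: A_def)
    then have "- (fst x, - snd x) \<in> annihilator P" using ann by blast
    then show "- x \<in> A" by (simp add: A_def uminus_prod_def)
  qed
  define L where "L = {n. \<exists>u. (u, n) \<in> A}"
  have span_L: "vec.span L = UNIV"
    using span_of_annihilator_projection[OF P fin] by (simp add: L_def A_def)
  have L: "add_subgroup L"
  proof -
    have "L = snd ` A" by (force simp: L_def)
    then show ?thesis using A unfolding add_subgroup_def
      by (auto simp: image_iff) (metis snd_zero, metis snd_add snd_conv, metis snd_uminus snd_conv)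
  qed
  have multiple: "\<exists>k>0. of_nat k *s v \<in> L" for v
    using span_of_subgroup[OF L] span_L by blast
  obtain M :: "rat^'m^'m" where M: "\<And>u n. (u, n) \<in> A \<Longrightarrow> u = M *v n"
  proof (rule subgroup_graph_in_linear_graph[OF A])
    show "u = 0" if "(u, 0) \<in> A" for u
      using that annihilator_of_surjection(1)[OF corr] by (simp add: A_def)
    show "vec.span {n. \<exists>u. (u, n) \<in> A} = UNIV" using span_L by (simp add: L_def)
  qed blast
  have A_iff: "(u, n) \<in> A \<longleftrightarrow> n \<in> L \<and> u = M *v n" for u n
    using M by (auto simp: L_def)
  have "v = 0" if v: "M *v v = 0" for v
  proof -
    obtain k where k: "k > 0" "of_nat k *s v \<in> L" using multiple by blast
    then have "(0, of_nat k *s v) \<in> A" by (simp add: A_iff vec.scale v)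
    then have "- (of_nat k *s v) = 0"
      unfolding A_def by (intro annihilator_of_surjection(2)[OF corr]) simp
    then show ?thesis using k(1) by (simp add: vec_eq_iff)
  qed
  then have "invertible M"
    unfolding invertible_left_inverse by (auto simp: matrix_left_invertible_ker)
  note M_inv = matrix_inv_matrix_inv[OF this]
  have "(matrix_inv M, L) \<in> GL_pairs"
    unfolding GL_pairs_iff
  proof (intro conjI)
    have "M *v n \<in> int_lattice \<and> - n \<in> int_lattice" if "n \<in> L" for n
    proof -
      have "(M *v n, - n) \<in> annihilator P" using that A_iff[of "M *v n" n] by (simp add: A_def)
      then show ?thesis by (simp add: annihilator_iff)
    qed
    then show "L \<subseteq> int_lattice" "\<forall>n\<in>L. matrix_inv (matrix_inv M) *v n \<in> int_lattice"
      unfolding M_inv(2) using int_lattice_closed(3) by fastforce+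
    show "\<exists>N>0. \<forall>v\<in>int_lattice. of_nat N *s v \<in> L"
      by (rule multiples_of_lattice[OF L multiple])
  qed (use M_inv L in auto)
  moreover have "annihilator P = theta_perp (matrix_inv M, L)"
  proof (intro set_eqI, clarify)
    fix u v
    show "(u, v) \<in> annihilator P \<longleftrightarrow> (u, v) \<in> theta_perp (matrix_inv M, L)"
      using A_iff[of u "- v"] unfolding mem_theta_perp_iff M_inv(2) by (simp add: A_def)
  qed
  then have "P = theta (matrix_inv M, L)"
    using theta_eqI[OF P] by simp
  ultimately show thesis by (rule that)
qed

section \<open>Products of correspondences\<close>

text \<open>
  The product is a continuous image of a closed set of triples in a compact space.
\<close>

lemma closed_corr_mult:
  fixes P1 P2 :: "('m::finite torus \<times> 'm torus) set"
  assumes "closed P1" "closed P2"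
  shows "closed (P1 \<star> P2)"
proof -
  define W :: "('m torus \<times> 'm torus \<times> 'm torus) set" where
    "W = {w. (fst w, fst (snd w)) \<in> P2} \<inter> {w. snd w \<in> P1}"
  have "closed {w :: 'm torus \<times> 'm torus \<times> 'm torus. (fst w, fst (snd w)) \<in> P2}"
    using closed_vimage[OF assms(2), of "\<lambda>w :: 'm torus \<times> 'm torus \<times> 'm torus. (fst w, fst (snd w))"]
    by (simp add: vimage_def continuous_on_Pair continuous_on_fst continuous_on_snd continuous_on_id)
  moreover have "closed {w :: 'm torus \<times> 'm torus \<times> 'm torus. snd w \<in> P1}"
    using closed_vimage[OF assms(1), of "snd :: 'm torus \<times> 'm torus \<times> 'm torus \<Rightarrow> _"]
    by (simp add: vimage_def continuous_on_snd continuous_on_id)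
  ultimately have "closed W" unfolding W_def by (rule closed_Int)
  moreover have "compact (UNIV :: ('m torus \<times> 'm torus \<times> 'm torus) set)"
    using compact_Times[OF compact_torus compact_torus_pair] by (simp add: UNIV_Times_UNIV)
  ultimately have "compact W" using closed_Int_compact by fastforce
  then have "compact ((\<lambda>w. (fst w, snd (snd w))) ` W)"
    by (rule compact_continuous_image[rotated]) (intro continuous_intros)
  moreover have "P1 \<star> P2 = (\<lambda>w. (fst w, snd (snd w))) ` W"
  proof (intro equalityI subsetI)
    fix z assume "z \<in> P1 \<star> P2"
    then obtain y where "(fst z, y) \<in> P2" "(y, snd z) \<in> P1" by (auto simp: corr_mult_def)
    then show "z \<in> (\<lambda>w. (fst w, snd (snd w))) ` W"
      by (intro image_eqI[of _ _ "(fst z, y, snd z)"]) (simp_all add: W_def)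
  next
    fix z assume "z \<in> (\<lambda>w. (fst w, snd (snd w))) ` W"
    then show "z \<in> P1 \<star> P2" by (auto simp: corr_mult_def W_def)
  qed
  ultimately show ?thesis by (simp add: compact_imp_closed)
qed

lemma add_subgroup_corr_mult:
  assumes "add_subgroup P1" "add_subgroup P2"
  shows "add_subgroup (P1 \<star> P2)"
  unfolding add_subgroup_def
proof (intro conjI ballI)
  show "0 \<in> P1 \<star> P2"
    using assms by (auto simp: add_subgroup_def corr_mult_def zero_prod_def)
  fix x x' assume "x \<in> P1 \<star> P2" "x' \<in> P1 \<star> P2"
  then obtain y y' where y: "(fst x, y) \<in> P2" "(y, snd x) \<in> P1" "(fst x', y') \<in> P2" "(y', snd x') \<in> P1"
    by (auto simp: corr_mult_def)
  have "(fst x, y) + (fst x', y') \<in> P2" "(y, snd x) + (y', snd x') \<in> P1"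
    using assms y unfolding add_subgroup_def by blast+
  then show "x + x' \<in> P1 \<star> P2"
    by (auto simp: corr_mult_def plus_prod_def)
next
  fix x assume "x \<in> P1 \<star> P2"
  then obtain y where y: "(fst x, y) \<in> P2" "(y, snd x) \<in> P1"
    by (auto simp: corr_mult_def)
  have "- (fst x, y) \<in> P2" "- (y, snd x) \<in> P1"
    using assms y unfolding add_subgroup_def by blast+
  then show "- x \<in> P1 \<star> P2"
    by (auto simp: corr_mult_def uminus_prod_def)
qed

lemma adjoint_action_mult: "adjoint_action Q' (adjoint_action Q t) = adjoint_action (Q ** Q') t"
proof -
  have "adjoint_action Q' (adjoint_action Q t) $ i = adjoint_action (Q ** Q') t $ i" for i
    unfolding pairing_axis[symmetric] pairing_mult[symmetric]
    by (simp add: matrix_vector_mul_assoc)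
  then show ?thesis by (simp add: vec_eq_iff)
qed

lemma zero_mem_theta:
  "(Q, L) \<in> GL_pairs \<Longrightarrow> (torus_of 0, torus_of 0) \<in> theta (Q, L)"
  by (simp add: theta_properties(4))

text \<open>
  Let \<open>(u, - n)\<close> annihilate the product.  The curve of \<open>Q Q'\<close> lies in the product and determines
  \<open>u\<close>.  All points \<open>(0, z)\<close> of \<open>\<theta>(Q, L)\<close> lie in the product, with middle point 0; this gives
  \<open>n \<in> L\<close>.  If \<open>(0, y) \<in> \<theta>(Q', L')\<close>, any \<open>z\<close> with \<open>(y, z) \<in> \<theta>(Q, L)\<close> gives a point
  \<open>(0, z)\<close> of the product, at which \<open>n\<close> takes the value of \<open>Q\<inverse> n\<close> at \<open>y\<close>; this gives
  \<open>Q\<inverse> n \<in> L'\<close>.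
\<close>

lemma corr_mult_theta:
  fixes Q Q' :: "rat^'m::finite^'m"
  assumes p: "(Q, L) \<in> GL_pairs" and p': "(Q', L') \<in> GL_pairs"
  shows "theta (Q, L) \<star> theta (Q', L') = theta (Q ** Q', L \<inter> (\<lambda>v. Q *v v) ` L')"
proof -
  let ?R = "theta (Q, L) \<star> theta (Q', L')"
  note D = GL_pairsD[OF p] and D' = GL_pairsD[OF p']
  note T = theta_properties[OF p] and T' = theta_properties[OF p']
  have R: "(torus_of s, torus_of t) \<in> ?R"
    if "(torus_of s, torus_of r) \<in> theta (Q', L')" "(torus_of r, torus_of t) \<in> theta (Q, L)" for s r t
    using that by (auto simp: corr_mult_def)
  have "annihilator ?R = theta_perp (Q ** Q', L \<inter> (\<lambda>v. Q *v v) ` L')"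
  proof (intro set_eqI, clarify)
    fix u v :: "rat^'m"
    define n where "n = - v"
    have v: "v = - n" by (simp add: n_def)
    have "(u, v) \<in> annihilator ?R \<longleftrightarrow>
      n \<in> L \<and> matrix_inv Q *v n \<in> L' \<and> u = matrix_inv Q' *v (matrix_inv Q *v n)"
    proof
      assume uv: "(u, v) \<in> annihilator ?R"
      have "v = - ((Q ** Q') *v u)"
        by (rule annihilator_along_curve[OF _ uv])
          (unfold adjoint_action_mult[symmetric], rule R[OF T'(5) T(5)])
      then have u: "u = matrix_inv Q' *v (matrix_inv Q *v n)"
        by (simp add: n_def matrix_vector_mul_assoc[symmetric] matrix_inv_apply D(1) D'(1))
      have n: "n \<in> int_lattice" using uv by (simp add: n_def annihilator_iff int_lattice_closed)
      have fibre: "pairing n t \<in> \<int>" if "(torus_of 0, torus_of t) \<in> ?R" for t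
      proof -
        have "pairing u 0 + pairing v t \<in> \<int>" using uv that unfolding annihilator_iff by blast
        then show ?thesis by (simp add: v pairing_minus_left)
      qed
      have nL: "n \<in> L"
      proof (rule ccontr)
        assume "n \<notin> L"
        then obtain t where t: "\<And>w. w \<in> L \<Longrightarrow> pairing w t \<in> \<int>" "pairing n t \<notin> \<int>"
          using sublattice_separation[OF D(4) n] by blast
        have "(torus_of 0, torus_of t) \<in> theta (Q, L)"
          unfolding T(4) using t(1) by simp
        then have "(torus_of 0, torus_of t) \<in> ?R" by (rule R[OF zero_mem_theta[OF p']])
        with fibre t(2) show False by blast
      qed
      moreover have "matrix_inv Q *v n \<in> L'"
      proof (rule ccontr)
        assume "matrix_inv Q *v n \<notin> L'"
        then obtain s where s: "\<And>w. w \<in> L' \<Longrightarrow> pairing w s \<in> \<int>" "pairing (matrix_inv Q *v n) s \<notin> \<int>"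
          using sublattice_separation[OF D'(4) D(5)[OF nL]] by blast
        have s_mem: "(torus_of 0, torus_of s) \<in> theta (Q', L')"
          unfolding T'(4) using s(1) by simp
        have "torus_of s \<in> fst ` theta (Q, L)"
          using theta_in_Pf[OF p] by (simp add: Pf_def correspondence_def)
        then obtain z where "(torus_of s, z) \<in> theta (Q, L)" by force
        moreover obtain t where "z = torus_of t" by (rule torus_cases)
        ultimately have t: "(torus_of s, torus_of t) \<in> theta (Q, L)" by simp
        then have "pairing (matrix_inv Q *v n) s - pairing n t \<in> \<int>"
          unfolding T(4) using nL by blast
        moreover have "pairing n t \<in> \<int>" by (rule fibre[OF R[OF s_mem t]])
        ultimately have "(pairing (matrix_inv Q *v n) s - pairing n t) + pairing n t \<in> \<int>"
          by (rule Ints_add)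
        with s(2) show False by simp
      qed
      ultimately show "n \<in> L \<and> matrix_inv Q *v n \<in> L' \<and> u = matrix_inv Q' *v (matrix_inv Q *v n)"
        using u by blast
    next
      assume n: "n \<in> L \<and> matrix_inv Q *v n \<in> L' \<and> u = matrix_inv Q' *v (matrix_inv Q *v n)"
      have "pairing u s + pairing v t \<in> \<int>" if st: "(torus_of s, torus_of t) \<in> ?R" for s t
      proof -
        obtain y where y: "(torus_of s, y) \<in> theta (Q', L')" "(y, torus_of t) \<in> theta (Q, L)"
          using st by (auto simp: corr_mult_def)
        obtain r where r: "y = torus_of r" by (rule torus_cases)
        have "pairing u s - pairing (matrix_inv Q *v n) r \<in> \<int>"
          using y(1) n unfolding r T'(4) by blast
        moreover have "pairing (matrix_inv Q *v n) r - pairing n t \<in> \<int>"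
          using y(2) n unfolding r T(4) by blast
        ultimately have "(pairing u s - pairing (matrix_inv Q *v n) r) +
            (pairing (matrix_inv Q *v n) r - pairing n t) \<in> \<int>"
          by (rule Ints_add)
        then show ?thesis by (simp add: v pairing_minus_left)
      qed
      then show "(u, v) \<in> annihilator ?R"
        using n D(3) D'(5) unfolding annihilator_iff v by (auto intro: int_lattice_closed)
    qed
    also have "\<dots> \<longleftrightarrow> (u, v) \<in> theta_perp (Q ** Q', L \<inter> (\<lambda>v. Q *v v) ` L')"
      unfolding mem_theta_perp_iff n_def[symmetric] Int_iff mem_image_mult_iff[OF D(1)]
        matrix_inv_product[OF D(1) D'(1)] matrix_vector_mul_assoc by blast
    finally show "(u, v) \<in> annihilator ?R \<longleftrightarrow>
      (u, v) \<in> theta_perp (Q ** Q', L \<inter> (\<lambda>v. Q *v v) ` L')" .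
  qed
  from theta_eqI[OF closed_corr_mult[OF T(1) T'(1)] add_subgroup_corr_mult[OF T(2) T'(2)] this]
  show ?thesis by simp
qed

section \<open>Connected correspondences\<close>

text \<open>
  If \<open>d Q\<close> is integral, the curve is periodic with respect to \<open>d \<int>\<^sup>m\<close>, so it is the image of a cube.
\<close>

lemma compact_range_curve:
  fixes Q :: "rat^'m::finite^'m"
  shows "compact (range (\<lambda>t. (torus_of (adjoint_action Q t), torus_of t)))"
proof -
  let ?c = "\<lambda>t. (torus_of (adjoint_action Q t), torus_of t)"
  obtain d :: nat where d: "d > 0" "\<And>v. v \<in> int_lattice \<Longrightarrow> of_nat d *s (Q *v v) \<in> int_lattice"
    using matrix_denominator by blast
  have "?c t \<in> ?c ` cbox 0 (\<chi> i. of_nat d)" for t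
  proof -
    define z :: "real^'m" where "z = (\<chi> i. of_int \<lfloor>t $ i / of_nat d\<rfloor>)"
    define t' where "t' = t - of_nat d *\<^sub>R z"
    have "t' \<in> cbox 0 (\<chi> i. of_nat d)"
    proof -
      have "t' $ i = of_nat d * frac (t $ i / of_nat d)" for i
        using d(1) by (simp add: t'_def z_def frac_def right_diff_distrib)
      then show ?thesis
        using d(1) by (simp add: mem_box_cart frac_lt_1 less_imp_le mult_left_le)
    qed
    moreover have "torus_of t = torus_of t'"
      by (simp add: torus_of_eq_iff t'_def z_def)
    moreover have "torus_of (adjoint_action Q t) = torus_of (adjoint_action Q t')"
    proof -
      have "adjoint_action Q t $ i - adjoint_action Q t' $ i \<in> \<int>" for i
      proof -
        have "adjoint_action Q t $ i - adjoint_action Q t' $ i = pairing (of_nat d *s (Q *v axis i 1)) z"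
          by (simp add: pairing_axis[symmetric] pairing_mult[symmetric] t'_def pairing_diff_right
              pairing_scale_left pairing_scale_right)
        also have "\<dots> \<in> \<int>"
          by (intro pairing_in_Ints d(2) int_lattice_closed) (simp add: z_def)
        finally show ?thesis .
      qed
      then show ?thesis by (simp add: torus_of_eq_iff)
    qed
    ultimately show ?thesis by (intro image_eqI[of _ _ t']) simp_all
  qed
  then have eq: "range ?c = ?c ` cbox 0 (\<chi> i. of_nat d)" by blast
  have "continuous_on UNIV ?c"
    by (intro continuous_on_Pair continuous_on_torus_of
        continuous_on_compose2[OF continuous_on_torus_of continuous_on_adjoint_action]) auto
  then have "continuous_on (cbox 0 (\<chi> i. of_nat d)) ?c"
    by (rule continuous_on_subset) simp
  then show ?thesis unfolding eq by (rule compact_continuous_image[OF _ compact_cbox])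
qed

text \<open>
  The curve is a closed subgroup.  A pair \<open>(u, v)\<close> of integral vectors annihilates it iff
  \<open>v = - Q u\<close>, that is, iff \<open>- v \<in> \<Lambda>\<^sub>Q\<close> and \<open>u = Q\<inverse> (- v)\<close>.
\<close>

lemma theta_Lambda_of_eq_curve:
  fixes Q :: "rat^'m::finite^'m"
  assumes Q: "invertible Q"
  shows "theta (Q, Lambda_of Q) = range (\<lambda>t. (torus_of (adjoint_action Q t), torus_of t))"
proof (rule theta_eqI)
  let ?C = "range (\<lambda>t. (torus_of (adjoint_action Q t), torus_of t))"
  show "closed ?C" by (rule compact_imp_closed[OF compact_range_curve])
  show "add_subgroup ?C"
    unfolding add_subgroup_def
  proof (intro conjI ballI)
    have "adjoint_action Q 0 = 0" by (simp add: adjoint_action_def vec_eq_iff)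
    then show "0 \<in> ?C"
      by (intro image_eqI[of _ _ 0]) (simp_all add: torus_of_zero zero_prod_def)
    fix x y assume "x \<in> ?C" "y \<in> ?C"
    then obtain s t where "x = (torus_of (adjoint_action Q s), torus_of s)"
      "y = (torus_of (adjoint_action Q t), torus_of t)" by blast
    then show "x + y \<in> ?C"
      by (intro image_eqI[of _ _ "s + t"]) (simp_all add: torus_of_add adjoint_action_add)
  next
    fix x assume "x \<in> ?C"
    then obtain s where "x = (torus_of (adjoint_action Q s), torus_of s)" by blast
    then show "- x \<in> ?C"
      by (intro image_eqI[of _ _ "- s"]) (simp_all add: torus_of_minus adjoint_action_minus)
  qed
  show "annihilator ?C = theta_perp (Q, Lambda_of Q)"
  proof (intro set_eqI, clarify)
    fix u v
    show "(u, v) \<in> annihilator ?C \<longleftrightarrow> (u, v) \<in> theta_perp (Q, Lambda_of Q)"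
    proof
      assume uv: "(u, v) \<in> annihilator ?C"
      have "v = - (Q *v u)" by (rule annihilator_along_curve[OF _ uv]) blast
      then have "u = matrix_inv Q *v (- v)" by (simp add: matrix_inv_apply[OF Q])
      moreover have "u \<in> int_lattice" "- v \<in> int_lattice"
        using uv by (simp_all add: annihilator_iff int_lattice_closed)
      ultimately show "(u, v) \<in> theta_perp (Q, Lambda_of Q)"
        by (simp add: mem_theta_perp_iff mem_Lambda_of_iff[OF Q])
    next
      assume uv: "(u, v) \<in> theta_perp (Q, Lambda_of Q)"
      note p = Lambda_of_GL_pair[OF Q]
      have "?C \<subseteq> theta (Q, Lambda_of Q)" using theta_properties(5)[OF p] by blast
      moreover have "(u, v) \<in> annihilator (theta (Q, Lambda_of Q))"
        using uv theta_properties(3)[OF p] by simp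
      ultimately show "(u, v) \<in> annihilator ?C" unfolding annihilator_iff by blast
    qed
  qed
qed

lemma connected_theta_Lambda_of:
  fixes Q :: "rat^'m::finite^'m"
  assumes "invertible Q" shows "connected (theta (Q, Lambda_of Q))"
  unfolding theta_Lambda_of_eq_curve[OF assms]
  by (intro connected_continuous_image[OF _ connected_UNIV] continuous_on_Pair continuous_on_torus_of
        continuous_on_compose2[OF continuous_on_torus_of continuous_on_adjoint_action]) auto

text \<open>
  For \<open>n \<in> \<Lambda>\<^sub>Q\<close> the character \<open>(Q\<inverse> n, - n)\<close> becomes trivial on \<open>\<theta>(Q, L)\<close> when it is raised to the
  power \<open>N\<close> with \<open>N n \<in> L\<close>.  Having finitely many values on a connected set, it is constant, hence
  trivial, so it belongs to the annihilator.
\<close>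

lemma connected_theta_imp:
  assumes p: "(Q, L) \<in> GL_pairs" and conn: "connected (theta (Q, L))"
  shows "L = Lambda_of Q"
proof
  note D = GL_pairsD[OF p] and T = theta_properties[OF p]
  show "L \<subseteq> Lambda_of Q" using p by (simp add: GL_pairs_def)
  show "Lambda_of Q \<subseteq> L"
  proof
    fix n assume n: "n \<in> Lambda_of Q"
    then have "matrix_inv Q *v n \<in> int_lattice" "- n \<in> int_lattice"
      by (auto simp: mem_Lambda_of_iff[OF D(1)] int_lattice_closed)
    then obtain a b where ab: "matrix_inv Q *v n = rat_vec a" "- n = rat_vec b"
      unfolding int_lattice_def by blast
    obtain N where N: "N > 0" "\<And>v. v \<in> int_lattice \<Longrightarrow> of_nat N *s v \<in> L"
      using p unfolding GL_pairs_iff by blast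
    have Nn: "of_nat N *s n \<in> L" using n by (intro N(2)) (simp add: mem_Lambda_of_iff[OF D(1)])
    have char: "pair_char a b (torus_of s, torus_of t) =
        exp (2 * of_real pi * \<i> * of_real (pairing (matrix_inv Q *v n) s - pairing n t))" for s t
      by (simp add: pair_char_def torus_char_torus_of ab[symmetric] exp_add[symmetric]
          pairing_minus_left algebra_simps)
    have root: "pair_char a b z ^ N = 1" if "z \<in> theta (Q, L)" for z
    proof -
      obtain s t where z: "z = (torus_of s, torus_of t)" by (metis torus_cases surj_pair)
      have "pairing (matrix_inv Q *v (of_nat N *s n)) s - pairing (of_nat N *s n) t \<in> \<int>"
        using that Nn unfolding z T(4) by blast
      then have "of_nat N * (pairing (matrix_inv Q *v n) s - pairing n t) \<in> \<int>"
        by (simp add: vec.scale pairing_scale_left right_diff_distrib)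
      then have "exp (2 * of_real pi * \<i> *
          of_real (of_nat N * (pairing (matrix_inv Q *v n) s - pairing n t))) = 1"
        by (simp only: exp_2pi_eq_1_iff)
      then show ?thesis
        unfolding z char exp_of_nat_mult[symmetric] by (simp add: mult_ac)
    qed
    have "finite (pair_char a b ` theta (Q, L))"
    proof (rule finite_subset)
      show "pair_char a b ` theta (Q, L) \<subseteq> {w. w ^ N = 1}" using root by blast
      show "finite {w :: complex. w ^ N = 1}" using N(1) by (intro finite_roots_unity) simp
    qed
    then have "pair_char a b constant_on theta (Q, L)"
      by (rule continuous_finite_range_constant[OF conn continuous_on_pair_char])
    moreover have "0 \<in> theta (Q, L)" using T(2) by (simp add: add_subgroup_def)
    moreover have "pair_char a b 0 = 1"
      by (rule unitary_character_zero[OF unitary_character_pair_char])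
    ultimately have "\<forall>z\<in>theta (Q, L). pair_char a b z = 1"
      unfolding constant_on_def by metis
    then have "(rat_vec a, rat_vec b) \<in> annihilator (theta (Q, L))"
      unfolding annihilator_def pair_char_def by (intro CollectI exI[of _ a] exI[of _ b] conjI refl) auto
    then have "- rat_vec b \<in> L" unfolding T(3) mem_theta_perp_iff by blast
    then show "n \<in> L" using ab(2) by (metis minus_minus)
  qed
qed

section \<open>The isomorphism\<close>

lemma semigroup_GL_pairs: "semigroup_on GL_pairs (\<odot>)"
  unfolding semigroup_on_def
proof (intro conjI ballI; clarify)
  fix Q Q' :: "rat^'m::finite^'m" and L L'
  assume p: "(Q, L) \<in> GL_pairs" "(Q', L') \<in> GL_pairs"
  show "(Q, L) \<odot> (Q', L') \<in> GL_pairs"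
    using pair_mult_GL_pairs[OF p] by simp
  fix Q'' :: "rat^'m^'m" and L''
  have inj: "inj ((*v) Q)"
    using matrix_inv_apply(2)[OF GL_pairsD(1)[OF p(1)]] by (rule inj_on_inverseI)
  have "(\<lambda>v. Q ** Q' *v v) ` L'' = (\<lambda>v. Q *v v) ` (\<lambda>v. Q' *v v) ` L''"
    by (simp add: image_image matrix_vector_mul_assoc)
  then show "(Q, L) \<odot> (Q', L') \<odot> (Q'', L'') = (Q, L) \<odot> ((Q', L') \<odot> (Q'', L''))"
    by (simp add: matrix_mul_assoc image_Int[OF inj] Int_assoc)
qed

lemma bij_betw_theta: "bij_betw theta GL_pairs Pf"
  unfolding bij_betw_def
proof (intro conjI equalityI subsetI)
  show "inj_on theta GL_pairs"
    by (rule inj_onI) (metis theta_inject surj_pair)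
  show "P \<in> Pf" if "P \<in> theta ` GL_pairs" for P :: "('m::finite torus \<times> 'm torus) set"
    using that theta_in_Pf by auto
  show "P \<in> theta ` GL_pairs" if "P \<in> Pf" for P :: "('m::finite torus \<times> 'm torus) set"
    using Pf_imp_theta[OF that] by (metis imageI)
qed

lemma theta_pair_mult:
  assumes "p \<in> GL_pairs" "p' \<in> GL_pairs"
  shows "theta (p \<odot> p') = theta p \<star> theta p'"
proof -
  obtain Q L Q' L' where "p = (Q, L)" "p' = (Q', L')" by (cases p, cases p')
  with assms show ?thesis using corr_mult_theta[of Q L Q' L'] by simp
qed

lemma semigroup_Pf: "semigroup_on (Pf :: ('m::finite torus \<times> 'm torus) set set) (\<star>)"
  unfolding semigroup_on_def
proof (intro conjI ballI)
  fix P P' :: "('m torus \<times> 'm torus) set" assume P: "P \<in> Pf" "P' \<in> Pf"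
  obtain Q L where p: "(Q, L) \<in> GL_pairs" "P = theta (Q, L)"
    using P(1) by (rule Pf_imp_theta)
  obtain Q' L' where p': "(Q', L') \<in> GL_pairs" "P' = theta (Q', L')"
    using P(2) by (rule Pf_imp_theta)
  show "P \<star> P' \<in> Pf"
    unfolding p(2) p'(2) corr_mult_theta[OF p(1) p'(1)]
    by (rule theta_in_Pf[OF pair_mult_GL_pairs[OF p(1) p'(1)]])
next
  fix P P' P'' :: "('m torus \<times> 'm torus) set"
  show "P \<star> P' \<star> P'' = P \<star> (P' \<star> P'')" by (auto simp: corr_mult_def)
qed

theorem proposition2p1:
  shows "semigroup_on (GL_pairs :: ((rat^'m::finite^'m) \<times> (rat^'m) set) set) (\<odot>) \<and>
    semigroup_on (Pf :: ('m torus \<times> 'm torus) set set) (\<star>) \<and>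
    semigroup_iso_on (theta :: (rat^'m^'m) \<times> (rat^'m) set \<Rightarrow> ('m torus \<times> 'm torus) set)
      GL_pairs (\<odot>) Pf (\<star>) \<and>
    (\<forall>(Q :: rat^'m^'m, \<Lambda>) \<in> GL_pairs.
      annihilator (theta (Q, \<Lambda>)) = {(matrix_inv Q *v n, - n) | n. n \<in> \<Lambda>}) \<and>
    (\<forall>P \<in> (Pf :: ('m torus \<times> 'm torus) set set).
      connected P \<longleftrightarrow> (\<exists>Q :: rat^'m^'m. invertible Q \<and> P = theta (Q, Lambda_of Q))) \<and>
    (\<forall>(Q :: rat^'m^'m, \<Lambda>) \<in> GL_pairs.
      (theta (Q, \<Lambda>))\<inverse> = theta (matrix_inv Q, (\<lambda>v. matrix_inv Q *v v) ` \<Lambda>))"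
proof (intro conjI ballI)
  show "semigroup_on (GL_pairs :: ((rat^'m::finite^'m) \<times> (rat^'m) set) set) (\<odot>)"
    by (rule semigroup_GL_pairs)
  show "semigroup_on (Pf :: ('m torus \<times> 'm torus) set set) (\<star>)"
    by (rule semigroup_Pf)
  show "semigroup_iso_on (theta :: (rat^'m^'m) \<times> (rat^'m) set \<Rightarrow> ('m torus \<times> 'm torus) set)
      GL_pairs (\<odot>) Pf (\<star>)"
    unfolding semigroup_iso_on_def using bij_betw_theta theta_pair_mult by blast
next
  fix p :: "(rat^'m^'m) \<times> (rat^'m) set" assume p: "p \<in> GL_pairs"
  show "case p of (Q, \<Lambda>) \<Rightarrow> annihilator (theta (Q, \<Lambda>)) = {(matrix_inv Q *v n, - n) | n. n \<in> \<Lambda>}"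
    using p by (cases p) (simp add: theta_properties(3) theta_perp_def)
  show "case p of (Q, \<Lambda>) \<Rightarrow>
      (theta (Q, \<Lambda>))\<inverse> = theta (matrix_inv Q, (\<lambda>v. matrix_inv Q *v v) ` \<Lambda>)"
    using p by (cases p) (simp add: theta_converse)
next
  fix P :: "('m torus \<times> 'm torus) set" assume "P \<in> Pf"
  then obtain Q L where p: "(Q, L) \<in> GL_pairs" "P = theta (Q, L)" by (rule Pf_imp_theta)
  show "connected P \<longleftrightarrow> (\<exists>Q :: rat^'m^'m. invertible Q \<and> P = theta (Q, Lambda_of Q))"
  proof
    assume "connected P"
    then have "L = Lambda_of Q" using connected_theta_imp[OF p(1)] p(2) by simp
    with p(2) GL_pairsD(1)[OF p(1)]
    show "\<exists>Q :: rat^'m^'m. invertible Q \<and> P = theta (Q, Lambda_of Q)" by blast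
  next
    assume "\<exists>Q :: rat^'m^'m. invertible Q \<and> P = theta (Q, Lambda_of Q)"
    then show "connected P" using connected_theta_Lambda_of by blast
  qed
qed

end
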